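(* Let $n>2$ and $r>0$ be integers. As polynomials in $p$ (for $p$ prime), both $f_n(p^r)$ and $f(\underbrace{1,\dots,1}_{n-1},p^r)$ have the same two leading terms $p^{(n-1)r}+p^{(n-1)r-1}$. In particular, $$\frac{f(\overbrace{1,\dots,1}^{n-1},p^r)}{f_n(p^r)}\longrightarrow 1\quad\text{as } p\to\infty .$$
   Context: An $n$-dimensional lattice is the $\mathbb{Z}$-span of $n$ linearly independent vectors in a Euclidean space; a sublattice of $\Lambda$ is a subset of $\Lambda$ which is itself an $n$-dimensional lattice. $f_n(m)$ is the number of sublattices of index $m$ in an $n$-dimensional lattice $\Lambda$. The invariant factors of a sublattice $\Lambda^*$ of $\Lambda$ are the diagonal entries $d_1\mid\cdots\mid d_n$ (positive integers) of the Smith normal form of the integer matrix expressing a basis of $\Lambda^*$ in a basis of $\Lambda$. $f(d_1,\dots,d_n)$ is the number of sublattices of $\Lambda$ with invariant factors $d_1,\dots,d_n$; in particular $f(1,\dots,1,m)$ (with $n-1$ ones) is the number of sublattices $\Lambda^*$ of index $m$ with $\Lambda/\Lambda^*$ cyclic. None of these numbers depends on $\Lambda$. The limit is over primes $p$ with $n,r$ fixed. *)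

theory Defs
  imports
    "HOL-Analysis.Euclidean_Space"
    "HOL-Computational_Algebra.Primes"
    "HOL-Computational_Algebra.Polynomial"
    "Jordan_Normal_Form.Matrix"
begin

definition int_span :: "nat \<Rightarrow> (nat \<Rightarrow> 'a::euclidean_space) \<Rightarrow> 'a set" where
  "int_span n b = {(\<Sum>i<n. real_of_int (c i) *\<^sub>R b i) | c :: nat \<Rightarrow> int. True}"

definition is_lattice_basis :: "nat \<Rightarrow> (nat \<Rightarrow> 'a::euclidean_space) \<Rightarrow> 'a set \<Rightarrow> bool" where
  "is_lattice_basis n b \<Lambda> \<longleftrightarrow>
     inj_on b {..<n} \<and> independent (b ` {..<n}) \<and> \<Lambda> = int_span n b"

definition is_lattice :: "nat \<Rightarrow> 'a::euclidean_space set \<Rightarrow> bool" where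
  "is_lattice n \<Lambda> \<longleftrightarrow> (\<exists>b. is_lattice_basis n b \<Lambda>)"

definition is_sublattice :: "nat \<Rightarrow> 'a::euclidean_space set \<Rightarrow> 'a set \<Rightarrow> bool" where
  "is_sublattice n M \<Lambda> \<longleftrightarrow> M \<subseteq> \<Lambda> \<and> is_lattice n M"

text \<open>The index is \<open>0\<close> if there are infinitely many cosets.\<close>

definition lattice_index :: "'a::euclidean_space set \<Rightarrow> 'a set \<Rightarrow> nat" where
  "lattice_index M \<Lambda> = card (\<Lambda> // {(x, y). x \<in> \<Lambda> \<and> y \<in> \<Lambda> \<and> x - y \<in> M})"

text \<open>For \<open>n \<times> n\<close> integer matrices of nonzero determinant only (all diagonal entries are
  required to be positive); \<open>invertible_mat\<close> over the integers means unimodular.\<close>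

definition has_smith_normal_form :: "int mat \<Rightarrow> nat list \<Rightarrow> bool" where
  "has_smith_normal_form A ds \<longleftrightarrow>
     (let n = length ds in
        A \<in> carrier_mat n n \<and>
        (\<forall>d\<in>set ds. 0 < d) \<and>
        (\<forall>i. Suc i < n \<longrightarrow> ds ! i dvd ds ! Suc i) \<and>
        (\<exists>P Q. P \<in> carrier_mat n n \<and> invertible_mat P \<and>
               Q \<in> carrier_mat n n \<and> invertible_mat Q \<and>
               P * A * Q = mat_diag n (\<lambda>i. int (ds ! i))))"

text \<open>Changing the bases multiplies \<open>A\<close> by unimodular matrices on both sides, so asking for some
  pair of bases is the same as asking for all of them.\<close>

definition has_invariant_factors ::
    "nat \<Rightarrow> 'a::euclidean_space set \<Rightarrow> 'a set \<Rightarrow> nat list \<Rightarrow> bool" where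
  "has_invariant_factors n M \<Lambda> ds \<longleftrightarrow>
     length ds = n \<and>
     (\<exists>b c A. is_lattice_basis n b \<Lambda> \<and> is_lattice_basis n c M \<and>
        A \<in> carrier_mat n n \<and>
        (\<forall>i<n. c i = (\<Sum>j<n. real_of_int (A $$ (i, j)) *\<^sub>R b j)) \<and>
        has_smith_normal_form A ds)"

definition num_sublattices_index :: "nat \<Rightarrow> 'a::euclidean_space set \<Rightarrow> nat \<Rightarrow> nat" where
  "num_sublattices_index n \<Lambda> m = card {M. is_sublattice n M \<Lambda> \<and> lattice_index M \<Lambda> = m}"

definition num_sublattices_invariant_factors ::
    "nat \<Rightarrow> 'a::euclidean_space set \<Rightarrow> nat list \<Rightarrow> nat" where
  "num_sublattices_invariant_factors n \<Lambda> ds =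
     card {M. is_sublattice n M \<Lambda> \<and> has_invariant_factors n M \<Lambda> ds}"

end

theory Submission
  imports Defs "HOL-Number_Theory.Cong"
begin

text \<open>
  Both counting functions are computed exactly, as polynomials in \<open>p\<close>, and the two leading terms are
  then read off.

  For the sublattices of index \<open>p ^ r\<close>, write the lattice as \<open>L \<oplus> \<int> u\<close> with \<open>L\<close> of rank one less. A
  sublattice is determined by its intersection \<open>M\<close> with \<open>L\<close>, its projection \<open>d\<int>\<close> to the last coordinate
  and a coset of \<open>M\<close> in \<open>L\<close>, all three being arbitrary, and its index is \<open>d\<close> times that of \<open>M\<close>. As there are
  as many cosets as the index of \<open>M\<close>, this gives the recursion
  \<open>f\<^bsub>n+1\<^esub>(p\<^sup>r) = (\<Sum>j\<le>r. p\<^sup>j f\<^sub>n(p\<^sup>j))\<close> (lemma \<open>card_sublattices_Suc\<close>). From rank 2 on, the summand \<open>j = r\<close>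
  alone produces the leading terms (lemma \<open>coeff_index_poly_top\<close>), and the induction starts with
  \<open>f\<^sub>2(p\<^sup>r) = 1 + p + \<dots> + p\<^sup>r\<close>.

  A sublattice has invariant factors \<open>1, \<dots>, 1, m\<close> if and only if it is the set of vectors on which a
  primitive integral functional is divisible by \<open>m\<close>: given adapted bases, the functional is the
  last coordinate (lemma \<open>cyclic_imp_cong_lattice\<close>), and conversely a functional with an entry 1 becomes
  a coordinate after a change of basis (lemma \<open>cong_lattice_cyclic\<close>). For \<open>m = p ^ r\<close> the functional is
  unique up to units modulo \<open>m\<close>, so it has exactly one normal form in which the first entry prime to
  \<open>p\<close> is 1. Counting normal forms by the position \<open>k\<close> of that entry gives
  \<open>\<Sum>k<n. p ^ ((n - 1) r - k)\<close> (lemma \<open>num_cyclic_sublattices\<close>).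

  Both polynomials are thus monic of degree \<open>(n - 1) r\<close>, and their quotient tends to 1.
\<close>

section \<open>Additive subgroups\<close>

definition add_subgroup :: "'a::ab_group_add set \<Rightarrow> bool" where
  "add_subgroup M \<longleftrightarrow> 0 \<in> M \<and> (\<forall>x\<in>M. \<forall>y\<in>M. x - y \<in> M)"

lemma add_subgroup_0: "add_subgroup M \<Longrightarrow> 0 \<in> M"
  by (simp add: add_subgroup_def)

lemma add_subgroup_diff: "add_subgroup M \<Longrightarrow> x \<in> M \<Longrightarrow> y \<in> M \<Longrightarrow> x - y \<in> M"
  by (simp add: add_subgroup_def)

lemma add_subgroup_uminus: "add_subgroup M \<Longrightarrow> x \<in> M \<Longrightarrow> - x \<in> M"
  using add_subgroup_diff[of M 0 x] add_subgroup_0[of M] by simp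

lemma add_subgroup_add: "add_subgroup M \<Longrightarrow> x \<in> M \<Longrightarrow> y \<in> M \<Longrightarrow> x + y \<in> M"
  using add_subgroup_diff[of M x "- y"] add_subgroup_uminus[of M y] by simp

lemma add_subgroup_Int: "add_subgroup M \<Longrightarrow> add_subgroup N \<Longrightarrow> add_subgroup (M \<inter> N)"
  by (auto simp: add_subgroup_def)

lemma add_subgroup_scale:
  fixes x :: "'a::real_vector"
  assumes M: "add_subgroup M" and x: "x \<in> M"
  shows "real_of_int k *\<^sub>R x \<in> M"
proof -
  have nat: "real m *\<^sub>R x \<in> M" for m
  proof (induction m)
    case 0 then show ?case using add_subgroup_0[OF M] by simp
  next
    case (Suc m)
    have "real (Suc m) *\<^sub>R x = real m *\<^sub>R x + x" by (simp add: algebra_simps)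
    then show ?case using add_subgroup_add[OF M Suc x] by simp
  qed
  show ?thesis
  proof (cases "k \<ge> 0")
    case True
    then show ?thesis using nat[of "nat k"] by simp
  next
    case False
    then show ?thesis using add_subgroup_uminus[OF M nat[of "nat (- k)"]] by simp
  qed
qed

section \<open>Adjoining one vector to a subgroup\<close>

text \<open>A lattice of rank \<open>n + 1\<close> has the form \<open>adjoin L u\<close> with a lattice \<open>L\<close> of rank \<open>n\<close>; inductions on the
  rank take off one vector in this way. The hypothesis \<open>u \<notin> span L\<close> below makes the sum \<open>L \<oplus> \<int> u\<close> direct.\<close>

definition adjoin :: "'a::real_vector set \<Rightarrow> 'a \<Rightarrow> 'a set" where
  "adjoin L u = {w + real_of_int k *\<^sub>R u | w k. w \<in> L}"

lemma adjoinI: "w \<in> L \<Longrightarrow> w + real_of_int k *\<^sub>R u \<in> adjoin L u"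
  by (auto simp: adjoin_def)

lemma adjoin_base: "w \<in> L \<Longrightarrow> w \<in> adjoin L u"
  using adjoinI[of w L 0 u] by simp

lemma adjoin_new: "0 \<in> L \<Longrightarrow> u \<in> adjoin L u"
  using adjoinI[of 0 L 1 u] by simp

lemma adjoinE:
  assumes "x \<in> adjoin L u"
  obtains w k where "w \<in> L" "x = w + real_of_int k *\<^sub>R u"
  using assms by (auto simp: adjoin_def)

lemma add_subgroup_adjoin:
  assumes "add_subgroup L"
  shows "add_subgroup (adjoin L u)"
  unfolding add_subgroup_def
proof (intro conjI ballI)
  show "0 \<in> adjoin L u" using assms by (simp add: add_subgroup_0 adjoin_base)
next
  fix x y assume "x \<in> adjoin L u" "y \<in> adjoin L u"
  then obtain w k w' k' where "w \<in> L" "x = w + real_of_int k *\<^sub>R u"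
      "w' \<in> L" "y = w' + real_of_int k' *\<^sub>R u"
    by (metis adjoinE)
  then have "x - y = (w - w') + real_of_int (k - k') *\<^sub>R u" "w - w' \<in> L"
    using assms by (auto simp: algebra_simps add_subgroup_diff)
  then show "x - y \<in> adjoin L u" by (metis adjoinI)
qed

lemma adjoin_subset:
  assumes "add_subgroup N" "L \<subseteq> N" "u \<in> N"
  shows "adjoin L u \<subseteq> N"
  using assms by (auto elim!: adjoinE intro!: add_subgroup_add add_subgroup_scale)

lemma adjoin_unique:
  assumes u: "u \<notin> span L" and w: "w \<in> L" "w' \<in> L"
    and eq: "w + real_of_int k *\<^sub>R u = w' + real_of_int k' *\<^sub>R u"
  shows "w = w' \<and> k = k'"
proof (cases "k = k'")
  case True then show ?thesis using eq by simp
next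
  case False
  have "real_of_int (k - k') *\<^sub>R u = w' - w" using eq by (simp add: algebra_simps)
  then have "u = inverse (real_of_int (k - k')) *\<^sub>R (w' - w)"
    using False by (metis eq_iff_diff_eq_0 left_inverse of_int_eq_0_iff scaleR_one scaleR_scaleR)
  then have "u \<in> span L" using w by (metis span_scale span_diff span_base)
  then show ?thesis using u by simp
qed

lemma multiple_shift_notin_span:
  assumes u: "u \<notin> span L" and v: "v \<in> L" and d: "d > (0::nat)" and "M \<subseteq> L"
  shows "v + real d *\<^sub>R u \<notin> span M"
proof
  assume "v + real d *\<^sub>R u \<in> span M"
  then have "v + real d *\<^sub>R u \<in> span L" using span_mono[OF \<open>M \<subseteq> L\<close>] by blast
  from span_diff[OF this span_base[OF v]]
  have "(v + real d *\<^sub>R u) - v \<in> span L" .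
  then have "real d *\<^sub>R u \<in> span L" by simp
  from span_scale[OF this] have "inverse (real d) *\<^sub>R (real d *\<^sub>R u) \<in> span L" .
  then show False using u d by simp
qed

section \<open>Integer spans and lattice bases\<close>

lemma int_span_0: "int_span 0 b = {0}"
  by (auto simp: int_span_def)

lemma int_span_Suc: "int_span (Suc n) b = adjoin (int_span n b) (b n)"
proof
  show "int_span (Suc n) b \<subseteq> adjoin (int_span n b) (b n)"
    by (auto simp: int_span_def adjoin_def)
next
  show "adjoin (int_span n b) (b n) \<subseteq> int_span (Suc n) b"
  proof
    fix x assume "x \<in> adjoin (int_span n b) (b n)"
    then obtain c k where x: "x = (\<Sum>i<n. real_of_int (c i) *\<^sub>R b i) + real_of_int k *\<^sub>R b n"
      by (auto simp: int_span_def adjoin_def)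
    then have "x = (\<Sum>i<Suc n. real_of_int ((c(n := k)) i) *\<^sub>R b i)" by simp
    then show "x \<in> int_span (Suc n) b" unfolding int_span_def by blast
  qed
qed

lemma add_subgroup_int_span: "add_subgroup (int_span n b)"
proof (induction n)
  case 0 then show ?case by (simp add: int_span_0 add_subgroup_def)
next
  case (Suc n) then show ?case by (simp add: int_span_Suc add_subgroup_adjoin)
qed

lemma int_span_base: "i < n \<Longrightarrow> b i \<in> int_span n b"
proof (induction n)
  case (Suc n)
  then show ?case
    using add_subgroup_0[OF add_subgroup_int_span[of n b]]
    by (cases "i = n") (auto simp: int_span_Suc intro: adjoin_new adjoin_base)
qed simp

lemma span_int_span: "span (int_span n b) = span (b ` {..<n})"
proof (rule span_eq[THEN iffD2], intro conjI)
  show "int_span n b \<subseteq> span (b ` {..<n})"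
    unfolding int_span_def by (auto intro!: span_sum span_scale intro: span_base)
  show "b ` {..<n} \<subseteq> span (int_span n b)"
    by (auto intro!: span_base int_span_base)
qed

lemma is_lattice_add_subgroup: "is_lattice n M \<Longrightarrow> add_subgroup M"
  by (auto simp: is_lattice_def is_lattice_basis_def add_subgroup_int_span)

lemma is_lattice_basis_Suc_iff:
  "is_lattice_basis (Suc n) b (int_span (Suc n) b) \<longleftrightarrow>
     is_lattice_basis n b (int_span n b) \<and> b n \<notin> span (int_span n b)"
proof -
  have "inj_on b {..<Suc n} \<and> independent (b ` {..<Suc n}) \<longleftrightarrow>
      inj_on b {..<n} \<and> independent (b ` {..<n}) \<and> b n \<notin> span (b ` {..<n})"
    using span_base[of "b n" "b ` {..<n}"]
    by (auto simp: lessThan_Suc independent_insert inj_on_insert)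
  then show ?thesis by (auto simp: is_lattice_basis_def span_int_span)
qed

lemma is_lattice_adjoin:
  assumes M: "is_lattice n M" and u: "u \<notin> span M"
  shows "is_lattice (Suc n) (adjoin M u)"
proof -
  obtain c where c: "is_lattice_basis n c M" using M by (auto simp: is_lattice_def)
  let ?c = "c(n := u)"
  have same: "int_span n ?c = int_span n c" by (simp add: int_span_def)
  have "is_lattice_basis n ?c (int_span n ?c)"
  proof -
    have "?c ` {..<n} = c ` {..<n}" by auto
    moreover have "inj_on ?c {..<n} = inj_on c {..<n}" by (auto simp: inj_on_def)
    ultimately show ?thesis using c by (simp add: is_lattice_basis_def)
  qed
  moreover have "M = int_span n c" using c by (simp add: is_lattice_basis_def)
  ultimately have "is_lattice_basis (Suc n) ?c (int_span (Suc n) ?c)"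
    using u by (simp add: is_lattice_basis_Suc_iff same)
  moreover have "int_span (Suc n) ?c = adjoin M u"
    using \<open>M = int_span n c\<close> by (simp add: int_span_Suc same)
  ultimately show ?thesis by (auto simp: is_lattice_def)
qed

section \<open>Transversals and the index\<close>

text \<open>A transversal turns the index, which is defined by a quotient set, into the cardinality of a set of
  vectors of \<open>L\<close>. It also supplies canonical coset representatives, which are needed to count the
  sublattices with a given projection and a given kernel.\<close>

definition transversal :: "'a::ab_group_add set \<Rightarrow> 'a set \<Rightarrow> 'a set \<Rightarrow> bool" where
  "transversal T M L \<longleftrightarrow> T \<subseteq> L \<and> (\<forall>x\<in>L. \<exists>!t. t \<in> T \<and> x - t \<in> M)"

lemma lattice_index_transversal:
  assumes M: "add_subgroup M" and T: "transversal T M L"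
  shows "lattice_index M L = card T"
proof -
  let ?R = "{(x, y). x \<in> L \<and> y \<in> L \<and> x - y \<in> M}"
  have TL: "T \<subseteq> L" and ex: "\<And>x. x \<in> L \<Longrightarrow> \<exists>!t. t \<in> T \<and> x - t \<in> M"
    using T by (auto simp: transversal_def)
  have "bij_betw (\<lambda>t. ?R `` {t}) T (L // ?R)"
    unfolding bij_betw_def
  proof
    show "inj_on (\<lambda>t. ?R `` {t}) T"
    proof (rule inj_onI)
      fix s t assume st: "s \<in> T" "t \<in> T" and eq: "?R `` {s} = ?R `` {t}"
      have "t \<in> ?R `` {t}" using st TL add_subgroup_0[OF M] by auto
      then have "s - t \<in> M" using eq by blast
      moreover have "s - s \<in> M" using add_subgroup_0[OF M] by simp
      ultimately show "s = t" using ex[of s] st TL by blast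
    qed
    show "(\<lambda>t. ?R `` {t}) ` T = L // ?R"
    proof
      show "(\<lambda>t. ?R `` {t}) ` T \<subseteq> L // ?R" using TL by (intro image_subsetI quotientI) blast
    next
      show "L // ?R \<subseteq> (\<lambda>t. ?R `` {t}) ` T"
      proof
        fix X assume "X \<in> L // ?R"
        then obtain x where x: "x \<in> L" "X = ?R `` {x}" by (auto elim: quotientE)
        then obtain t where t: "t \<in> T" "x - t \<in> M" using ex by blast
        have "x - y \<in> M \<longleftrightarrow> t - y \<in> M" for y
          using add_subgroup_add[OF M t(2), of "t - y"] add_subgroup_diff[OF M _ t(2), of "x - y"]
          by auto
        then have "X = ?R `` {t}" using x t TL by auto
        then show "X \<in> (\<lambda>t. ?R `` {t}) ` T" using t by blast
      qed
    qed
  qed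
  from bij_betw_same_card[OF this] show ?thesis by (simp only: lattice_index_def)
qed

text \<open>Among the multiples of \<open>x\<close> two lie in the same coset, by the pigeonhole principle; their
  difference is the required multiple.\<close>

lemma finite_index_torsion:
  assumes M: "add_subgroup M" and L: "add_subgroup L" and pos: "lattice_index M L > 0"
    and x: "x \<in> L"
  shows "\<exists>k::nat. k > 0 \<and> real k *\<^sub>R x \<in> M"
proof -
  let ?R = "{(x, y). x \<in> L \<and> y \<in> L \<and> x - y \<in> M}"
  define f where "f k = ?R `` {real k *\<^sub>R x}" for k :: nat
  have fin: "finite (L // ?R)" using pos unfolding lattice_index_def by (rule card_ge_0_finite)
  have kL: "real k *\<^sub>R x \<in> L" for k
    using add_subgroup_scale[OF L x, of "int k"] by simp
  have "range f \<subseteq> L // ?R" unfolding f_def using kL by (intro image_subsetI quotientI)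
  then have "finite (range f)" using fin by (rule finite_subset)
  then have "\<not> inj f" using finite_imageD infinite_UNIV_nat by blast
  then obtain i' j' where "i' \<noteq> j'" "f i' = f j'" by (auto simp only: inj_def)
  then obtain i j where ij: "i < j" "f i = f j" by (cases i' j' rule: linorder_cases) auto
  have "real i *\<^sub>R x \<in> f i" using kL add_subgroup_0[OF M] by (auto simp: f_def)
  then have "real i *\<^sub>R x \<in> f j" using ij(2) by simp
  then have "real j *\<^sub>R x - real i *\<^sub>R x \<in> M" by (simp add: f_def)
  moreover have "real j *\<^sub>R x - real i *\<^sub>R x = real (j - i) *\<^sub>R x"
    using ij(1) by (simp add: of_nat_diff algebra_simps)
  ultimately show ?thesis using ij(1) by (intro exI[of _ "j - i"]) auto
qed

lemma adjoin_Int_base: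
  assumes "u \<notin> span L" "add_subgroup M" "M \<subseteq> L" "v \<in> L" "d \<noteq> 0" "add_subgroup L"
  shows "adjoin M (v + real_of_int d *\<^sub>R u) \<inter> L = M"
proof
  show "adjoin M (v + real_of_int d *\<^sub>R u) \<inter> L \<subseteq> M"
  proof
    fix x assume x: "x \<in> adjoin M (v + real_of_int d *\<^sub>R u) \<inter> L"
    then obtain w k where w: "w \<in> M" "x = w + real_of_int k *\<^sub>R (v + real_of_int d *\<^sub>R u)"
      unfolding adjoin_def by blast
    have "(w + real_of_int k *\<^sub>R v) + real_of_int (k * d) *\<^sub>R u = x + real_of_int 0 *\<^sub>R u"
      using w by (simp add: algebra_simps)
    moreover have "w + real_of_int k *\<^sub>R v \<in> L"
      using assms w by (auto intro!: add_subgroup_add add_subgroup_scale)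
    ultimately have "k * d = 0" using adjoin_unique[OF assms(1)] x by blast
    then show "x \<in> M" using w assms by simp
  qed
  show "M \<subseteq> adjoin M (v + real_of_int d *\<^sub>R u) \<inter> L" using assms by (auto intro: adjoin_base)
qed

text \<open>The \<open>u\<close>-coordinates of the elements of \<open>M\<close> form a subgroup of \<open>\<int>\<close>, and \<open>d\<close> is its generator. Division with
  remainder by \<open>d\<close> moves any element of \<open>M\<close> into \<open>L\<close>. The multiple of \<open>u\<close> in \<open>M\<close> excludes the zero
  subgroup, for which there would be no such \<open>d\<close>.\<close>

lemma subgroup_adjoin_decomp:
  assumes L: "add_subgroup L" and u: "u \<notin> span L" and M: "add_subgroup M" "M \<subseteq> adjoin L u"
    and k: "k > 0" "real k *\<^sub>R u \<in> M"
  shows "\<exists>v d. v \<in> L \<and> d > (0::nat) \<and> M = adjoin (M \<inter> L) (v + real d *\<^sub>R u)"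
proof -
  define D where "D = {d::nat. d > 0 \<and> (\<exists>v\<in>L. v + real d *\<^sub>R u \<in> M)}"
  have "k \<in> D" using k add_subgroup_0[OF L] by (auto simp: D_def intro!: bexI[of _ 0])
  define d where "d = (LEAST d. d \<in> D)"
  have dD: "d \<in> D" unfolding d_def using \<open>k \<in> D\<close> by (rule LeastI)
  have least: "e \<in> D \<Longrightarrow> d \<le> e" for e unfolding d_def by (rule Least_le)
  obtain v where v: "v \<in> L" "v + real d *\<^sub>R u \<in> M" "d > 0" using dD by (auto simp: D_def)
  let ?y = "v + real d *\<^sub>R u"
  have "M \<subseteq> adjoin (M \<inter> L) ?y"
  proof
    fix x assume x: "x \<in> M"
    then obtain w j where w: "w \<in> L" "x = w + real_of_int j *\<^sub>R u" using M(2) unfolding adjoin_def by blast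
    define q where "q = j div int d"
    define e where "e = j mod int d"
    have j: "j = q * int d + e" by (simp add: q_def e_def)
    have e: "0 \<le> e" "e < int d" using v(3) by (auto simp: e_def)
    let ?z = "x - real_of_int q *\<^sub>R ?y"
    have z: "?z = (w - real_of_int q *\<^sub>R v) + real (nat e) *\<^sub>R u"
      using e by (simp add: w j algebra_simps)
    have zM: "?z \<in> M" using M x v by (auto intro!: add_subgroup_diff add_subgroup_scale)
    have wL: "w - real_of_int q *\<^sub>R v \<in> L" using L w v by (auto intro!: add_subgroup_diff add_subgroup_scale)
    have "nat e \<notin> D" using least[of "nat e"] e by auto
    then have "nat e = 0" using zM wL z unfolding D_def by (metis (mono_tags, lifting) mem_Collect_eq not_gr0)
    then have "?z \<in> M \<inter> L" using zM wL z by simp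
    then have "?z + real_of_int q *\<^sub>R ?y \<in> adjoin (M \<inter> L) ?y" by (rule adjoinI)
    then show "x \<in> adjoin (M \<inter> L) ?y" by simp
  qed
  moreover have "adjoin (M \<inter> L) ?y \<subseteq> M" using M v by (intro adjoin_subset) auto
  ultimately show ?thesis using v by blast
qed

text \<open>Reduction modulo \<open>v + d u\<close> brings the \<open>u\<close>-coordinate into \<open>{0..<d}\<close>, and reduction modulo \<open>M\<close> then brings
  the component in \<open>L\<close> into \<open>T\<close>. So the index of the enlarged sublattice is \<open>d\<close> times the old one.\<close>

lemma transversal_adjoin:
  assumes L: "add_subgroup L" and u: "u \<notin> span L" and M: "add_subgroup M" "M \<subseteq> L"
    and T: "transversal T M L" and v: "v \<in> L" and d: "d > (0::nat)"
  defines "f \<equiv> \<lambda>(t, j::nat). t + real j *\<^sub>R u"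
  shows "transversal (f ` (T \<times> {..<d})) (adjoin M (v + real d *\<^sub>R u)) (adjoin L u)"
    and "card (f ` (T \<times> {..<d})) = card T * d"
proof -
  have TL: "T \<subseteq> L" and ex: "\<And>x. x \<in> L \<Longrightarrow> \<exists>!t. t \<in> T \<and> x - t \<in> M"
    using T by (auto simp: transversal_def)
  let ?N = "adjoin M (v + real d *\<^sub>R u)"
  have "inj_on f (T \<times> {..<d})"
  proof (rule inj_onI, clarify)
    fix t j t' j' assume h: "t \<in> T" "t' \<in> T" "f (t, j) = f (t', j')"
    then have "t + real_of_int (int j) *\<^sub>R u = t' + real_of_int (int j') *\<^sub>R u" by (simp add: f_def)
    then show "t = t' \<and> j = j'" using adjoin_unique[OF u] h TL by (metis int_int_eq subsetD)
  qed
  then show "card (f ` (T \<times> {..<d})) = card T * d"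
    by (simp add: card_image card_cartesian_product)
  have uniq: "t = t' \<and> j = j'"
    if h: "t \<in> T" "t' \<in> T" "j < d" "j' < d" "f (t, j) - f (t', j') \<in> ?N" for t t' j j'
  proof -
    obtain w k where w: "w \<in> M" "f (t, j) - f (t', j') = w + real_of_int k *\<^sub>R (v + real d *\<^sub>R u)"
      using h(5) unfolding adjoin_def by blast
    have "(t - t') + real_of_int (int j - int j') *\<^sub>R u
        = (w + real_of_int k *\<^sub>R v) + real_of_int (k * int d) *\<^sub>R u"
      using w(2) by (simp add: f_def algebra_simps)
    moreover have "t - t' \<in> L" "w + real_of_int k *\<^sub>R v \<in> L"
      using L TL h w M v by (auto intro!: add_subgroup_diff add_subgroup_add add_subgroup_scale)
    ultimately have eq: "t - t' = w + real_of_int k *\<^sub>R v" "int j - int j' = k * int d"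
      using adjoin_unique[OF u] by blast+
    have "\<bar>k * int d\<bar> < int d" using eq(2) h(3,4) by linarith
    then have "\<bar>k\<bar> * int d < 1 * int d" by (simp add: abs_mult)
    then have "k = 0" by (subst (asm) mult_less_cancel_right) auto
    then have "j = j'" "t - t' \<in> M" using eq w by auto
    moreover have "t = t'" 
      using ex[of t] h(1,2) TL \<open>t - t' \<in> M\<close> add_subgroup_0[OF M(1)] by (metis diff_self subsetD)
    ultimately show ?thesis by simp
  qed
  show "transversal (f ` (T \<times> {..<d})) ?N (adjoin L u)"
    unfolding transversal_def
  proof (intro conjI ballI)
    show "f ` (T \<times> {..<d}) \<subseteq> adjoin L u"
    proof clarify
      fix t j assume "t \<in> T" 
      then show "f (t, j) \<in> adjoin L u" using adjoinI[of t L "int j" u] TL by (auto simp: f_def)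
    qed
  next
    fix x assume "x \<in> adjoin L u"
    then obtain w i where w: "w \<in> L" "x = w + real_of_int i *\<^sub>R u" unfolding adjoin_def by blast
    define q where "q = i div int d"
    define e where "e = nat (i mod int d)"
    have i: "i = q * int d + int e" and e: "e < d" using d by (auto simp: q_def e_def nat_less_iff)
    have "w - real_of_int q *\<^sub>R v \<in> L" using L w v by (auto intro!: add_subgroup_diff add_subgroup_scale)
    then obtain t where t: "t \<in> T" "w - real_of_int q *\<^sub>R v - t \<in> M" using ex by blast
    have "x - f (t, e) = (w - real_of_int q *\<^sub>R v - t) + real_of_int q *\<^sub>R (v + real d *\<^sub>R u)"
      by (simp add: w i f_def algebra_simps)
    then have x1: "x - f (t, e) \<in> ?N" using t by (metis adjoinI)
    show "\<exists>!s. s \<in> f ` (T \<times> {..<d}) \<and> x - s \<in> ?N"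
    proof (rule ex1I[of _ "f (t, e)"])
      show "f (t, e) \<in> f ` (T \<times> {..<d}) \<and> x - f (t, e) \<in> ?N" using t e x1 by auto
    next
      fix s assume s: "s \<in> f ` (T \<times> {..<d}) \<and> x - s \<in> ?N"
      then obtain t' j' where s': "s = f (t', j')" "t' \<in> T" "j' < d" by auto
      have "f (t, e) - f (t', j') \<in> ?N"
        using add_subgroup_diff[OF add_subgroup_adjoin[OF M(1)], of "x - s" _ "x - f (t, e)"] s x1 s'
        by auto
      then show "s = f (t, e)" using uniq s' t e by blast
    qed
  qed
qed

section \<open>Subgroups of finite index are lattices\<close>

text \<open>The last hypothesis is the form of finite index that passes to \<open>M \<inter> L\<close> without any work. Both
  conclusions are proved in one induction on the rank because the step for either one takes apart
  \<open>M\<close> in the same way.\<close>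

lemma finite_index_subgroup_structure:
  fixes b :: "nat \<Rightarrow> 'a::euclidean_space"
  assumes "is_lattice_basis n b (int_span n b)" "add_subgroup M" "M \<subseteq> int_span n b"
    and "\<And>x. x \<in> int_span n b \<Longrightarrow> \<exists>k::nat. k > 0 \<and> real k *\<^sub>R x \<in> M"
  shows "is_lattice n M \<and> (\<exists>T. finite T \<and> transversal T M (int_span n b))"
  using assms
proof (induction n arbitrary: M)
  case 0
  then have "M = {0}" using add_subgroup_0 by (auto simp: int_span_0)
  then have "transversal {0} M (int_span 0 b)" by (auto simp: transversal_def int_span_0)
  moreover have "is_lattice 0 M" using \<open>M = {0}\<close>
    by (auto simp: is_lattice_def is_lattice_basis_def int_span_0 independent_empty)
  ultimately show ?case by blast
next
  case (Suc n)
  let ?L = "int_span n b"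
  have b: "is_lattice_basis n b ?L" "b n \<notin> span ?L"
    using Suc.prems(1) by (auto simp: is_lattice_basis_Suc_iff)
  have L: "add_subgroup ?L" by (rule add_subgroup_int_span)
  obtain k where k: "k > 0" "real k *\<^sub>R b n \<in> M"
    using Suc.prems(4)[of "b n"] int_span_base[of n "Suc n" b] by auto
  obtain v d where vd: "v \<in> ?L" "d > (0::nat)" "M = adjoin (M \<inter> ?L) (v + real d *\<^sub>R b n)"
    using subgroup_adjoin_decomp[OF L b(2) Suc.prems(2) _ k] Suc.prems(3) by (auto simp: int_span_Suc)
  let ?M = "M \<inter> ?L"
  have sub: "add_subgroup ?M" using Suc.prems(2) L by (rule add_subgroup_Int)
  have tors: "\<exists>k::nat. k > 0 \<and> real k *\<^sub>R x \<in> ?M" if xL: "x \<in> ?L" for x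
  proof -
    obtain k :: nat where "k > 0" "real k *\<^sub>R x \<in> M"
      using Suc.prems(4)[of x] adjoin_base[OF xL] by (auto simp: int_span_Suc)
    then show ?thesis using add_subgroup_scale[OF L xL, of "int k"] by auto
  qed
  from Suc.IH[OF b(1) sub _ tors] obtain T where
    T: "is_lattice n ?M" "finite T" "transversal T ?M ?L" by auto
  have "v + real d *\<^sub>R b n \<notin> span ?M"
    by (rule multiple_shift_notin_span) (use b vd in auto)
  then have "is_lattice (Suc n) M" using is_lattice_adjoin[OF T(1)] vd(3) by metis
  moreover have "transversal ((\<lambda>(t, j). t + real j *\<^sub>R b n) ` (T \<times> {..<d})) M (int_span (Suc n) b)"
    using transversal_adjoin(1)[OF L b(2) sub _ T(3) vd(1,2)] vd(3) by (simp add: int_span_Suc)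
  ultimately show ?case using T(2) by (metis finite_SigmaI finite_imageI finite_lessThan)
qed

section \<open>Counting sublattices of prime power index\<close>

definition sublattices_of_index :: "nat \<Rightarrow> 'a::euclidean_space set \<Rightarrow> nat \<Rightarrow> 'a set set" where
  "sublattices_of_index n L m = {M. is_sublattice n M L \<and> lattice_index M L = m}"

lemma sublattices_iff_transversal:
  assumes b: "is_lattice_basis n b (int_span n b)" and m: "m > 0"
  shows "M \<in> sublattices_of_index n (int_span n b) m \<longleftrightarrow> is_sublattice n M (int_span n b) \<and>
    (\<exists>T. finite T \<and> card T = m \<and> transversal T M (int_span n b))"
proof -
  let ?L = "int_span n b"
  have "\<exists>T. finite T \<and> card T = m \<and> transversal T M ?L"
    if M: "is_sublattice n M ?L" and i: "lattice_index M ?L = m"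
  proof -
    have sub: "add_subgroup M" "M \<subseteq> ?L"
      using M by (auto simp: is_sublattice_def is_lattice_add_subgroup)
    have "\<exists>k::nat. k > 0 \<and> real k *\<^sub>R x \<in> M" if "x \<in> ?L" for x
      by (rule finite_index_torsion[OF sub(1) add_subgroup_int_span _ that]) (use m i in simp)
    then obtain T where "finite T" "transversal T M ?L"
      using finite_index_subgroup_structure[OF b sub] by blast
    then show ?thesis using lattice_index_transversal[OF sub(1)] i by auto
  qed
  then show ?thesis
    using lattice_index_transversal[of M _ ?L]
    by (auto simp: sublattices_of_index_def is_sublattice_def is_lattice_add_subgroup)
qed

lemma transversal_unique:
  assumes "transversal T M L" "s \<in> T" "t \<in> T" "s - t \<in> M" "add_subgroup M"
  shows "s = t"
proof -
  have "s \<in> L" using assms by (auto simp: transversal_def)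
  then have "\<exists>!t. t \<in> T \<and> s - t \<in> M" using assms by (auto simp: transversal_def)
  moreover have "s - s \<in> M" using assms by (simp add: add_subgroup_0)
  ultimately show ?thesis using assms by blast
qed

lemma adjoin_change_generator:
  assumes M: "add_subgroup M" and v: "v - t \<in> M"
  shows "adjoin M (v + u) = adjoin M (t + u)"
proof -
  have *: "adjoin M (v + u) \<subseteq> adjoin M (t + u)" if v: "v - t \<in> M" for v t
  proof (rule adjoin_subset[OF add_subgroup_adjoin[OF M]])
    show "M \<subseteq> adjoin M (t + u)" by (auto intro: adjoin_base)
    have "(v - t) + real_of_int 1 *\<^sub>R (t + u) \<in> adjoin M (t + u)" by (rule adjoinI[OF v])
    then show "v + u \<in> adjoin M (t + u)" by simp
  qed
  show ?thesis using *[OF v] *[of t v] add_subgroup_uminus[OF M v] by auto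
qed

text \<open>Each of the two generators is a multiple of the other modulo \<open>M\<close>; comparing \<open>u\<close>-coordinates gives
  \<open>d dvd d'\<close> and \<open>d' dvd d\<close>. So \<open>v\<close> is determined modulo \<open>M\<close> and \<open>d\<close> is determined exactly.\<close>

lemma adjoin_eq_imp:
  assumes L: "add_subgroup L" and u: "u \<notin> span L" and M: "add_subgroup M" "M \<subseteq> L"
    and v: "v \<in> L" "v' \<in> L" and d: "d > (0::nat)" "d' > (0::nat)"
    and eq: "adjoin M (v + real d *\<^sub>R u) = adjoin M (v' + real d' *\<^sub>R u)"
  shows "d = d' \<and> v - v' \<in> M"
proof -
  have *: "\<exists>k. int d = k * int d' \<and> v - real_of_int k *\<^sub>R v' \<in> M"
    if v: "v \<in> L" "v' \<in> L" and sub: "adjoin M (v + real d *\<^sub>R u) \<subseteq> adjoin M (v' + real d' *\<^sub>R u)"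
    for v v' and d d' :: nat
  proof -
    have "v + real d *\<^sub>R u \<in> adjoin M (v' + real d' *\<^sub>R u)"
      using sub adjoin_new[OF add_subgroup_0[OF M(1)]] by blast
    then obtain w k where w: "w \<in> M" "v + real d *\<^sub>R u = w + real_of_int k *\<^sub>R (v' + real d' *\<^sub>R u)"
      unfolding adjoin_def by blast
    then have "v + real_of_int (int d) *\<^sub>R u = (w + real_of_int k *\<^sub>R v') + real_of_int (k * int d') *\<^sub>R u"
      by (simp add: algebra_simps)
    moreover have "w + real_of_int k *\<^sub>R v' \<in> L"
      using L v w M by (auto intro!: add_subgroup_add add_subgroup_scale)
    ultimately have "v = w + real_of_int k *\<^sub>R v' \<and> int d = k * int d'"
      using adjoin_unique[OF u v(1)] by blast
    then show ?thesis using w by (intro exI[of _ k]) auto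
  qed
  obtain k where k: "int d = k * int d'" "v - real_of_int k *\<^sub>R v' \<in> M" using *[OF v] eq by blast
  obtain k' where k': "int d' = k' * int d" using *[OF v(2,1)] eq by blast
  have "d dvd d'" "d' dvd d" using k(1) k' by (metis dvd_triv_right int_dvd_int_iff)+
  then have "d = d'" by (rule dvd_antisym)
  then have "k = 1" using k(1) d by simp
  then show ?thesis using k(2) \<open>d = d'\<close> by simp
qed

text \<open>A sublattice \<open>X\<close> of \<open>L \<oplus> \<int> u\<close> is the same as a triple of its intersection \<open>M\<close> with \<open>L\<close>, the positive
  generator \<open>d\<close> of its projection to \<open>\<int> u\<close>, and the coset of \<open>M\<close> in \<open>L\<close> formed by the \<open>v\<close> with \<open>v + d u \<in> X\<close>.
  Its index is \<open>d\<close> times that of \<open>M\<close>. If the index is \<open>p ^ r\<close>, then \<open>M\<close> has index \<open>p ^ j\<close> with \<open>j \<le> r\<close>,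
  this determines \<open>d\<close>, and there are \<open>p ^ j\<close> cosets.\<close>

lemma card_sublattices_Suc:
  fixes b :: "nat \<Rightarrow> 'a::euclidean_space"
  assumes b: "is_lattice_basis (Suc n) b (int_span (Suc n) b)" and p: "prime (p::nat)"
    and fin: "\<And>j. finite (sublattices_of_index n (int_span n b) (p ^ j))"
  shows "finite (sublattices_of_index (Suc n) (int_span (Suc n) b) (p ^ r))"
    and "card (sublattices_of_index (Suc n) (int_span (Suc n) b) (p ^ r))
      = (\<Sum>j\<le>r. p ^ j * card (sublattices_of_index n (int_span n b) (p ^ j)))"
proof -
  let ?L = "int_span n b" and ?u = "b n" and ?N = "int_span (Suc n) b"
  have bn: "is_lattice_basis n b ?L" and u: "?u \<notin> span ?L"
    using b by (auto simp: is_lattice_basis_Suc_iff)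
  have L: "add_subgroup ?L" by (rule add_subgroup_int_span)
  have p0: "p ^ j > 0" for j using p by (simp add: prime_gt_0_nat)
  have p1: "p > 1" using p by (rule prime_gt_1_nat)
  define S where "S j = sublattices_of_index n ?L (p ^ j)" for j
  define T where "T M = (SOME T. finite T \<and> transversal T M ?L)" for M
  have S: "add_subgroup M \<and> M \<subseteq> ?L \<and> is_lattice n M" if "M \<in> S j" for M j
    using that by (auto simp: S_def sublattices_of_index_def is_sublattice_def is_lattice_add_subgroup)
  have T: "finite (T M) \<and> transversal (T M) M ?L \<and> card (T M) = p ^ j" if M: "M \<in> S j" for M j
  proof -
    have "\<exists>T. finite T \<and> transversal T M ?L"
      using M sublattices_iff_transversal[OF bn p0] unfolding S_def by blast
    then have *: "finite (T M) \<and> transversal (T M) M ?L" unfolding T_def by (rule someI_ex)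
    moreover have "lattice_index M ?L = p ^ j" using M by (simp add: S_def sublattices_of_index_def)
    ultimately show ?thesis using lattice_index_transversal S[OF M] by metis
  qed
  have TL: "t \<in> ?L" if "M \<in> S j" "t \<in> T M" for M j t
    using T[OF that(1)] that(2) by (auto simp: transversal_def)
  \<comment> \<open>The parameters are the exponent of the index of \<open>M\<close>, then \<open>M\<close>, then the representative of the coset.\<close>
  define A where "A = (SIGMA j:{..r}. SIGMA M:S j. T M)"
  define f where "f = (\<lambda>(j, M, t). adjoin M (t + real (p ^ (r - j)) *\<^sub>R ?u))"
  have Int: "f (j, M, t) \<inter> ?L = M" if "M \<in> S j" "t \<in> T M" for j M t
    using adjoin_Int_base[OF u _ _ TL[OF that] _ L, of M "int (p ^ (r - j))"] S[OF that(1)] p1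
    by (simp add: f_def)
  have inj: "inj_on f A"
  proof (rule inj_onI)
    fix x y assume "x \<in> A" "y \<in> A" and eq: "f x = f y"
    then obtain j M t j' M' t' where x: "x = (j, M, t)" "j \<le> r" "M \<in> S j" "t \<in> T M"
      and y: "y = (j', M', t')" "j' \<le> r" "M' \<in> S j'" "t' \<in> T M'"
      by (auto simp: A_def)
    have M: "M = M'" using Int[OF x(3,4)] Int[OF y(3,4)] eq x y by simp
    have "p ^ (r - j) = p ^ (r - j') \<and> t - t' \<in> M"
      by (rule adjoin_eq_imp[OF L u _ _ TL[OF x(3,4)] TL[OF y(3,4)]])
         (use S[OF x(3)] p0 eq x y M in \<open>auto simp: f_def\<close>)
    then have "j = j'" "t - t' \<in> M"
      using power_inject_exp[OF p1] x(2) y(2) by auto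
    moreover have "t = t'" using transversal_unique[of "T M" M ?L t t'] T[OF x(3)] S[OF x(3)] x y M
      \<open>t - t' \<in> M\<close> by auto
    ultimately show "x = y" using x y M by simp
  qed
  have img: "f ` A = sublattices_of_index (Suc n) ?N (p ^ r)"
  proof
    show "f ` A \<subseteq> sublattices_of_index (Suc n) ?N (p ^ r)"
    proof
      fix X assume "X \<in> f ` A"
      then obtain j M t where h: "X = f (j, M, t)" "j \<le> r" "M \<in> S j" "t \<in> T M" by (auto simp: A_def)
      let ?d = "p ^ (r - j)"
      have X: "X = adjoin M (t + real ?d *\<^sub>R ?u)" using h by (simp add: f_def)
      note M = S[OF h(3)] note tL = TL[OF h(3,4)]
      have "t + real ?d *\<^sub>R ?u \<notin> span M"
        by (rule multiple_shift_notin_span) (use M tL u p0 in auto)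
      then have "is_lattice (Suc n) X" using M X is_lattice_adjoin by blast
      moreover have "X \<subseteq> ?N" unfolding X int_span_Suc
      proof (rule adjoin_subset[OF add_subgroup_adjoin[OF L]])
        show "M \<subseteq> adjoin ?L ?u" using M by (auto intro: adjoin_base)
        show "t + real ?d *\<^sub>R ?u \<in> adjoin ?L ?u"
          using adjoinI[OF tL, of "int ?d" ?u] by simp
      qed
      moreover have "lattice_index X ?N = p ^ r"
      proof -
        have "transversal (T M) M ?L" "card (T M) = p ^ j" using T[OF h(3)] by auto
        note tr = transversal_adjoin[OF L u _ _ this(1) tL p0[of "r - j"]]
        have "lattice_index X ?N = card (T M) * ?d"
          using lattice_index_transversal[OF add_subgroup_adjoin tr(1)] M tr(2)
          by (simp add: X int_span_Suc)
        then show ?thesis using \<open>card (T M) = p ^ j\<close> h(2) by (simp flip: power_add)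
      qed
      ultimately show "X \<in> sublattices_of_index (Suc n) ?N (p ^ r)"
        by (simp add: sublattices_of_index_def is_sublattice_def)
    qed
  next
    show "sublattices_of_index (Suc n) ?N (p ^ r) \<subseteq> f ` A"
    proof
      fix X assume X: "X \<in> sublattices_of_index (Suc n) ?N (p ^ r)"
      then have Xsub: "add_subgroup X" "X \<subseteq> ?N" and idx: "lattice_index X ?N = p ^ r"
        by (auto simp: sublattices_of_index_def is_sublattice_def is_lattice_add_subgroup)
      have tors: "\<exists>k::nat. k > 0 \<and> real k *\<^sub>R x \<in> X" if "x \<in> ?N" for x
        by (rule finite_index_torsion[OF Xsub(1) add_subgroup_int_span _ that]) (use p0 idx in simp)
      obtain k where k: "k > 0" "real k *\<^sub>R ?u \<in> X"
        using tors[of ?u] int_span_base[of n "Suc n" b] by auto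
      obtain v d where vd: "v \<in> ?L" "d > (0::nat)" "X = adjoin (X \<inter> ?L) (v + real d *\<^sub>R ?u)"
        using subgroup_adjoin_decomp[OF L u Xsub(1) _ k] Xsub(2) by (auto simp: int_span_Suc)
      let ?M = "X \<inter> ?L"
      have M: "add_subgroup ?M" using Xsub(1) L by (rule add_subgroup_Int)
      have "\<exists>k::nat. k > 0 \<and> real k *\<^sub>R x \<in> ?M" if xL: "x \<in> ?L" for x
      proof -
        obtain k :: nat where "k > 0" "real k *\<^sub>R x \<in> X"
          using tors[of x] adjoin_base[OF xL] by (auto simp: int_span_Suc)
        then show ?thesis using add_subgroup_scale[OF L xL, of "int k"] by auto
      qed
      with finite_index_subgroup_structure[OF bn M] obtain T0 where
        T0: "is_lattice n ?M" "finite T0" "transversal T0 ?M ?L" by auto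
      note tr = transversal_adjoin[OF L u M _ T0(3) vd(1,2)]
      have "lattice_index X ?N = card T0 * d"
        using lattice_index_transversal[OF add_subgroup_adjoin[OF M] tr(1)] tr(2) vd(3)
        by (simp add: int_span_Suc)
      then have cd: "card T0 * d = p ^ r" using idx by simp
      then have "card T0 dvd p ^ r" by (metis dvd_triv_left)
      then obtain j where j: "j \<le> r" "card T0 = p ^ j" using divides_primepow_nat[OF p] by blast
      have d: "d = p ^ (r - j)"
      proof -
        have "p ^ j * d = p ^ j * p ^ (r - j)" using cd j by (simp flip: power_add)
        then show ?thesis using p1 by simp
      qed
      have MS: "?M \<in> S j"
        using lattice_index_transversal[OF M T0(3)] T0(1) j(2)
        by (simp add: S_def sublattices_of_index_def is_sublattice_def)
      obtain t where t: "t \<in> T ?M" "v - t \<in> ?M"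
        using T[OF MS] vd(1) unfolding transversal_def by blast
      have "X = f (j, ?M, t)"
        using adjoin_change_generator[OF M t(2)] vd(3) by (simp add: f_def d)
      moreover have "(j, ?M, t) \<in> A" using j MS t by (simp add: A_def)
      ultimately show "X \<in> f ` A" by blast
    qed
  qed
  have finA: "finite A" unfolding A_def
    using fin T by (intro finite_SigmaI) (auto simp: S_def)
  then show "finite (sublattices_of_index (Suc n) ?N (p ^ r))" using img by (metis finite_imageI)
  have "card (sublattices_of_index (Suc n) ?N (p ^ r)) = card A"
    using card_image[OF inj] img by simp
  also have "\<dots> = (\<Sum>j\<le>r. \<Sum>M\<in>S j. card (T M))"
    unfolding A_def using fin T by (simp add: S_def card_SigmaI)
  also have "\<dots> = (\<Sum>j\<le>r. p ^ j * card (S j))"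
    using T by (intro sum.cong) auto
  finally show "card (sublattices_of_index (Suc n) ?N (p ^ r))
      = (\<Sum>j\<le>r. p ^ j * card (sublattices_of_index n ?L (p ^ j)))" by (simp add: S_def)
qed

primrec index_poly :: "nat \<Rightarrow> nat \<Rightarrow> int poly" where
  "index_poly 0 r = (if r = 0 then 1 else 0)"
| "index_poly (Suc n) r = (\<Sum>j\<le>r. monom 1 j * index_poly n j)"

lemma card_sublattices_prime_power:
  assumes "is_lattice_basis n b (int_span n b)" and p: "prime (p::nat)"
  shows "finite (sublattices_of_index n (int_span n b) (p ^ r))
    \<and> int (card (sublattices_of_index n (int_span n b) (p ^ r))) = poly (index_poly n r) (int p)"
  using assms(1)
proof (induction n arbitrary: r)
  case 0
  have "M = {0}" if "is_sublattice 0 M {0::'a}" for M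
    using that by (auto simp: is_sublattice_def is_lattice_def is_lattice_basis_def int_span_0)
  moreover have "is_sublattice 0 {0} {0::'a}"
    by (auto simp: is_sublattice_def is_lattice_def is_lattice_basis_def int_span_0 independent_empty)
  moreover have "lattice_index {0} {0::'a} = 1"
    using lattice_index_transversal[of "{0::'a}" "{0}" "{0}"]
    by (auto simp: transversal_def add_subgroup_def)
  moreover have "p ^ r = 1 \<longleftrightarrow> r = 0" using prime_gt_1_nat[OF p] by auto
  ultimately have "sublattices_of_index 0 (int_span 0 b) (p ^ r) = (if r = 0 then {{0}} else {})"
    unfolding sublattices_of_index_def int_span_0 by (cases "r = 0") (force, metis (mono_tags) Collect_empty_eq)
  then show ?case by simp
next
  case (Suc n)
  have bn: "is_lattice_basis n b (int_span n b)"
    using Suc.prems by (simp add: is_lattice_basis_Suc_iff)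
  note IH = Suc.IH[OF bn]
  note c = card_sublattices_Suc[OF Suc.prems p]
  show ?case
    using c[of r] IH by (simp add: poly_sum poly_monom)
qed

section \<open>Changing the basis of a lattice\<close>

lemma int_span_least:
  assumes "add_subgroup M" "\<And>i. i < n \<Longrightarrow> b i \<in> M"
  shows "int_span n b \<subseteq> M"
  using assms(2)
proof (induction n)
  case 0 then show ?case using assms(1) by (simp add: int_span_0 add_subgroup_0)
next
  case (Suc n)
  then show ?case unfolding int_span_Suc by (intro adjoin_subset[OF assms(1)]) auto
qed

lemma int_spanI: "(\<Sum>i<n. real_of_int (c i) *\<^sub>R b i) \<in> int_span n b"
  unfolding int_span_def by blast

text \<open>Here \<open>b'\<close> consists of \<open>n\<close> vectors that span a space of dimension at least \<open>n\<close>, so they are distinct and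
  independent.\<close>

lemma is_lattice_basis_int_span:
  fixes b :: "nat \<Rightarrow> 'a::euclidean_space"
  assumes b: "is_lattice_basis n b L" and span: "\<And>i. i < n \<Longrightarrow> b i \<in> span (b' ` {..<n})"
  shows "is_lattice_basis n b' (int_span n b')"
proof -
  let ?B = "b ` {..<n}" and ?B' = "b' ` {..<n}"
  have B: "independent ?B" "card ?B = n" using b by (auto simp: is_lattice_basis_def card_image)
  have "n = dim ?B" using B by (simp add: dim_eq_card_independent)
  also have "\<dots> \<le> dim (span ?B')" by (rule dim_subset) (use span in auto)
  finally have n: "n \<le> dim ?B'" by simp
  have d: "dim ?B' \<le> card ?B'" by (simp add: dim_le_card')
  have c: "card ?B' \<le> n" using card_image_le[of "{..<n}" b'] by simp
  have "inj_on b' {..<n}" using n c d by (intro eq_card_imp_inj_on) auto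
  moreover have "independent ?B'"
    by (rule card_le_dim_spanning[of _ ?B']) (use n c in \<open>auto intro: span_base\<close>)
  ultimately show ?thesis by (simp add: is_lattice_basis_def)
qed

lemma is_lattice_basis_cong:
  assumes "\<And>i. i < n \<Longrightarrow> b i = b' i"
  shows "is_lattice_basis n b L \<longleftrightarrow> is_lattice_basis n b' L"
proof -
  have "b ` {..<n} = b' ` {..<n}" "inj_on b {..<n} = inj_on b' {..<n}"
    using assms by (auto simp: inj_on_def)
  moreover have "int_span n b = int_span n b'" using assms by (simp add: int_span_def)
  ultimately show ?thesis by (simp add: is_lattice_basis_def)
qed

lemma lattice_coordinates_unique:
  assumes b: "is_lattice_basis n b L"
    and eq: "(\<Sum>i<n. real_of_int (c i) *\<^sub>R b i) = (\<Sum>i<n. real_of_int (c' i) *\<^sub>R b i)"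
    and i: "i < n"
  shows "c i = c' i"
proof -
  have inj: "inj_on b {..<n}" and ind: "independent (b ` {..<n})"
    using b by (auto simp: is_lattice_basis_def)
  define g where "g v = real_of_int (c (inv_into {..<n} b v) - c' (inv_into {..<n} b v))" for v
  have "(\<Sum>v\<in>b ` {..<n}. g v *\<^sub>R v) = (\<Sum>i<n. real_of_int (c i - c' i) *\<^sub>R b i)"
    using inj by (simp add: sum.reindex g_def)
  also have "\<dots> = 0" using eq by (simp add: scaleR_diff_left sum_subtractf)
  finally have "\<forall>v\<in>b ` {..<n}. g v = 0" using ind by (auto simp: independent_explicit)
  then show ?thesis using i inj by (auto simp: g_def)
qed

text \<open>The rows of \<open>A\<close> as coordinate vectors with respect to \<open>b\<close>; this is how the definition of the
  invariant factors relates two bases.\<close>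

definition mat_comb :: "int mat \<Rightarrow> nat \<Rightarrow> (nat \<Rightarrow> 'a::real_vector) \<Rightarrow> nat \<Rightarrow> 'a" where
  "mat_comb A n b i = (\<Sum>j<n. real_of_int (A $$ (i, j)) *\<^sub>R b j)"

lemma mat_comb_mult:
  assumes "A \<in> carrier_mat n n" "B \<in> carrier_mat n n" "i < n"
  shows "mat_comb (A * B) n b i = mat_comb A n (mat_comb B n b) i"
proof -
  have "mat_comb (A * B) n b i
      = (\<Sum>j<n. \<Sum>k<n. real_of_int (A $$ (i, k) * B $$ (k, j)) *\<^sub>R b j)"
    using assms unfolding mat_comb_def
    by (intro sum.cong refl) (simp add: scalar_prod_def lessThan_atLeast0 flip: scaleR_sum_left)
  also have "\<dots> = (\<Sum>k<n. \<Sum>j<n. real_of_int (A $$ (i, k) * B $$ (k, j)) *\<^sub>R b j)"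
    by (rule sum.swap)
  also have "\<dots> = mat_comb A n (mat_comb B n b) i"
    by (simp add: mat_comb_def scaleR_sum_right)
  finally show ?thesis .
qed

lemma mat_comb_diag:
  assumes "i < n"
  shows "mat_comb (mat_diag n d) n b i = real_of_int (d i) *\<^sub>R b i"
proof -
  have "mat_comb (mat_diag n d) n b i = (\<Sum>j<n. if j = i then real_of_int (d i) *\<^sub>R b i else 0)"
    unfolding mat_comb_def using assms by (intro sum.cong) (auto simp: mat_diag_def)
  then show ?thesis using assms by simp
qed

lemma mat_comb_one: "i < n \<Longrightarrow> mat_comb (1\<^sub>m n) n b i = b i"
  using mat_comb_diag[of i n "\<lambda>_. 1" b] by (simp add: mat_diag_one)

lemma mat_comb_cong: "(\<And>j. j < n \<Longrightarrow> b j = b' j) \<Longrightarrow> mat_comb A n b i = mat_comb A n b' i"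
  by (simp add: mat_comb_def)

lemma unimodular_change_of_basis:
  assumes b: "is_lattice_basis n b L"
    and U: "U \<in> carrier_mat n n" "V \<in> carrier_mat n n" "V * U = 1\<^sub>m n"
  shows "is_lattice_basis n (mat_comb U n b) L"
proof -
  have L: "L = int_span n b" using b by (simp add: is_lattice_basis_def)
  have "b i \<in> int_span n (mat_comb U n b)" if "i < n" for i
  proof -
    have "b i = mat_comb V n (mat_comb U n b) i"
      using mat_comb_mult[OF U(2,1) that] U(3) mat_comb_one[OF that] by metis
    then show ?thesis by (metis mat_comb_def int_spanI)
  qed
  note gen = this
  have "mat_comb U n b i \<in> int_span n b" for i unfolding mat_comb_def by (rule int_spanI)
  then have "int_span n (mat_comb U n b) = L"
    unfolding L using gen by (intro equalityI int_span_least add_subgroup_int_span)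
  moreover have "is_lattice_basis n (mat_comb U n b) (int_span n (mat_comb U n b))"
    by (rule is_lattice_basis_int_span[OF b]) (metis gen span_base span_int_span)
  ultimately show ?thesis by simp
qed

lemma invertible_mat_inverse:
  assumes "invertible_mat A" "A \<in> carrier_mat n n"
  obtains B where "B \<in> carrier_mat n n" "A * B = 1\<^sub>m n" "B * A = 1\<^sub>m n"
proof -
  obtain B where B: "A * B = 1\<^sub>m n" "B * A = 1\<^sub>m (dim_row B)"
    using assms by (auto simp: invertible_mat_def inverts_mat_def)
  have "dim_col (A * B) = n" "dim_col (B * A) = dim_row B" unfolding B by auto
  then have "B \<in> carrier_mat n n" using assms(2) by auto
  then show ?thesis using B that by auto
qed

section \<open>Invariant factors and adapted bases\<close>

text \<open>From \<open>P * A * Q = D\<close> follows \<open>P * A = D * Q\<^sup>-\<^sup>1\<close>. So the rows of \<open>Q\<^sup>-\<^sup>1\<close> give a basis of \<open>L\<close>, those of \<open>P\<close>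
  give a basis of \<open>M\<close>, and the second is the first one scaled by the invariant factors. This
  removes matrices from the rest of the argument.\<close>

lemma has_invariant_factors_iff:
  "has_invariant_factors n M L ds \<longleftrightarrow>
     length ds = n \<and> (\<forall>d\<in>set ds. 0 < d) \<and> (\<forall>i. Suc i < n \<longrightarrow> ds ! i dvd ds ! Suc i) \<and>
     (\<exists>b. is_lattice_basis n b L \<and> is_lattice_basis n (\<lambda>i. real (ds ! i) *\<^sub>R b i) M)"
  (is "_ \<longleftrightarrow> ?R")
proof
  assume "has_invariant_factors n M L ds"
  then obtain b c A where len: "length ds = n" and b: "is_lattice_basis n b L"
    and c: "is_lattice_basis n c M" and A: "A \<in> carrier_mat n n"
    and cA: "\<And>i. i < n \<Longrightarrow> c i = mat_comb A n b i" and snf: "has_smith_normal_form A ds"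
    by (auto simp: has_invariant_factors_def mat_comb_def)
  obtain P Q where P: "P \<in> carrier_mat n n" "invertible_mat P"
    and Q: "Q \<in> carrier_mat n n" "invertible_mat Q"
    and PAQ: "P * A * Q = mat_diag n (\<lambda>i. int (ds ! i))"
    using snf len by (auto simp: has_smith_normal_form_def Let_def)
  obtain P' where P': "P' \<in> carrier_mat n n" "P' * P = 1\<^sub>m n" using invertible_mat_inverse P by metis
  obtain Q' where Q': "Q' \<in> carrier_mat n n" "Q * Q' = 1\<^sub>m n" using invertible_mat_inverse Q by metis
  let ?D = "mat_diag n (\<lambda>i. int (ds ! i))"
  have PA: "P * A \<in> carrier_mat n n" using P A by simp
  have "P * A = P * A * (Q * Q')" unfolding Q'(2) using PA by (rule right_mult_one_mat[symmetric])
  also have "\<dots> = ?D * Q'" using PA Q(1) Q'(1) PAQ by (metis assoc_mult_mat)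
  finally have fact: "P * A = ?D * Q'" .
  have "mat_comb P n c i = real (ds ! i) *\<^sub>R mat_comb Q' n b i" if i: "i < n" for i
  proof -
    have "mat_comb P n c i = mat_comb P n (mat_comb A n b) i" using cA by (rule mat_comb_cong)
    also have "\<dots> = mat_comb (?D * Q') n b i" using mat_comb_mult[OF P(1) A i] fact by metis
    also have "\<dots> = mat_comb ?D n (mat_comb Q' n b) i" by (rule mat_comb_mult[OF _ Q'(1) i]) simp
    finally show ?thesis using i by (simp add: mat_comb_diag)
  qed
  from is_lattice_basis_cong[of n "mat_comb P n c", OF this]
  have "is_lattice_basis n (\<lambda>i. real (ds ! i) *\<^sub>R mat_comb Q' n b i) M"
    using unimodular_change_of_basis[OF c P(1) P'] by simp
  moreover have "is_lattice_basis n (mat_comb Q' n b) L"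
    by (rule unimodular_change_of_basis[OF b Q'(1) Q(1) Q'(2)])
  ultimately show ?R using snf len by (auto simp: has_smith_normal_form_def Let_def)
next
  assume R: ?R
  then obtain b where b: "is_lattice_basis n b L" "is_lattice_basis n (\<lambda>i. real (ds ! i) *\<^sub>R b i) M"
    by blast
  let ?D = "mat_diag n (\<lambda>i. int (ds ! i))"
  have one: "invertible_mat (1\<^sub>m n :: int mat)"
    by (auto simp: invertible_mat_def inverts_mat_def intro!: exI[of _ "1\<^sub>m n"])
  have "1\<^sub>m n * ?D * 1\<^sub>m n = ?D"
    by (simp add: left_mult_one_mat[OF mat_diag_dim] right_mult_one_mat[OF mat_diag_dim])
  then have "has_smith_normal_form ?D ds"
    using R one by (auto simp: has_smith_normal_form_def Let_def intro!: exI[of _ "1\<^sub>m n"])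
  moreover have "real (ds ! i) *\<^sub>R b i = mat_comb ?D n b i" if "i < n" for i
    using that by (simp add: mat_comb_diag)
  ultimately show "has_invariant_factors n M L ds"
    using R b unfolding has_invariant_factors_def mat_comb_def
    by (intro conjI exI[of _ b] exI[of _ "\<lambda>i. real (ds ! i) *\<^sub>R b i"] exI[of _ ?D]) auto
qed

section \<open>Cyclic quotients and congruence sublattices\<close>

definition cong_lattice :: "nat \<Rightarrow> (nat \<Rightarrow> 'a::real_vector) \<Rightarrow> (nat \<Rightarrow> int) \<Rightarrow> int \<Rightarrow> 'a set" where
  "cong_lattice n b a m = {\<Sum>i<n. real_of_int (c i) *\<^sub>R b i | c. m dvd (\<Sum>i<n. a i * c i)}"

lemma in_cong_lattice_iff:
  assumes b: "is_lattice_basis n b L"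
  shows "(\<Sum>i<n. real_of_int (c i) *\<^sub>R b i) \<in> cong_lattice n b a m \<longleftrightarrow> m dvd (\<Sum>i<n. a i * c i)"
proof
  assume "(\<Sum>i<n. real_of_int (c i) *\<^sub>R b i) \<in> cong_lattice n b a m"
  then obtain c' where c': "(\<Sum>i<n. real_of_int (c i) *\<^sub>R b i) = (\<Sum>i<n. real_of_int (c' i) *\<^sub>R b i)"
    "m dvd (\<Sum>i<n. a i * c' i)" unfolding cong_lattice_def by blast
  have "(\<Sum>i<n. a i * c i) = (\<Sum>i<n. a i * c' i)"
    using lattice_coordinates_unique[OF b c'(1)] by simp
  then show "m dvd (\<Sum>i<n. a i * c i)" using c'(2) by simp
qed (auto simp: cong_lattice_def)

lemma cong_lattice_one: "cong_lattice n b a 1 = int_span n b"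
  by (auto simp: cong_lattice_def int_span_def)

text \<open>The functional that defines \<open>M\<close> is the last coordinate with respect to a basis adapted to \<open>M\<close>, and
  \<open>a\<close> lists its values on \<open>b\<close>. It takes the value 1 on the last vector of the adapted basis, so the
  entries of \<open>a\<close> have no common divisor.\<close>

lemma cyclic_imp_cong_lattice:
  fixes b :: "nat \<Rightarrow> 'a::euclidean_space"
  assumes n: "n > 0" and b: "is_lattice_basis n b L"
    and M: "has_invariant_factors n M L (replicate (n - 1) 1 @ [m])"
  shows "\<exists>a. M = cong_lattice n b a (int m) \<and> (\<forall>d. (\<forall>i<n. d dvd a i) \<longrightarrow> d dvd 1)"
proof -
  let ?l = "n - 1"
  define d where "d i = (if i = ?l then m else 1)" for i
  have ds: "(replicate (n - 1) 1 @ [m]) ! i = d i" if "i < n" for i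
    using that by (auto simp: d_def nth_append)
  obtain b' where b': "is_lattice_basis n b' L"
    "is_lattice_basis n (\<lambda>i. real ((replicate (n - 1) 1 @ [m]) ! i) *\<^sub>R b' i) M"
    using M unfolding has_invariant_factors_iff by blast
  then have b'M: "is_lattice_basis n (\<lambda>i. real (d i) *\<^sub>R b' i) M"
    by (subst is_lattice_basis_cong[of n _ "\<lambda>i. real ((replicate (n - 1) 1 @ [m]) ! i) *\<^sub>R b' i"])
       (simp_all only: ds)
  have inj: "inj_on b' {..<n}" and ind: "independent (b' ` {..<n})"
    using b'(1) by (auto simp: is_lattice_basis_def)
  obtain f :: "'a \<Rightarrow> real" where f: "linear f"
    and fb: "\<forall>x\<in>b' ` {..<n}. f x = (if x = b' ?l then 1 else 0)"
    using linear_independent_extend[OF ind, of "\<lambda>x. if x = b' ?l then 1 else 0"] by blast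
  have f': "f (b' i) = (if i = ?l then 1 else 0)" if "i < n" for i
    using fb that inj n by (auto simp: inj_on_def)
  have fsum: "f (\<Sum>i<n. real_of_int (c i) *\<^sub>R b' i) = real_of_int (c ?l)" for c
  proof -
    have "f (\<Sum>i<n. real_of_int (c i) *\<^sub>R b' i) = (\<Sum>i<n. real_of_int (c i) * f (b' i))"
      using f by (simp add: linear_sum linear_scale)
    also have "\<dots> = (\<Sum>i<n. if i = ?l then real_of_int (c ?l) else 0)"
      by (intro sum.cong) (auto simp: f')
    finally show ?thesis using n by simp
  qed
  have L: "L = int_span n b" "L = int_span n b'" and MM: "M = int_span n (\<lambda>i. real (d i) *\<^sub>R b' i)"
    using b b'(1) b'M by (auto simp: is_lattice_basis_def)
  have "\<exists>z. f (b i) = real_of_int z" if "i < n" for i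
  proof -
    have "b i \<in> int_span n b'" using int_span_base[OF that, of b] L by simp
    then obtain c where "b i = (\<Sum>i<n. real_of_int (c i) *\<^sub>R b' i)" unfolding int_span_def by blast
    then show ?thesis using fsum by metis
  qed
  then obtain a where a: "\<And>i. i < n \<Longrightarrow> f (b i) = real_of_int (a i)" by metis
  have fa: "f (\<Sum>i<n. real_of_int (c i) *\<^sub>R b i) = real_of_int (\<Sum>i<n. a i * c i)" for c
    using f a by (simp add: linear_sum linear_scale mult.commute)
  have Miff: "x \<in> M \<longleftrightarrow> x \<in> L \<and> (\<exists>k::int. f x = real_of_int (int m * k))" for x
  proof
    assume "x \<in> M"
    then obtain c where "x = (\<Sum>i<n. real_of_int (c i) *\<^sub>R real (d i) *\<^sub>R b' i)"
      unfolding MM int_span_def by blast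
    then have x: "x = (\<Sum>i<n. real_of_int (c i * int (d i)) *\<^sub>R b' i)" by simp
    have "f x = real_of_int (int m * c ?l)" unfolding x fsum by (simp add: d_def)
    moreover have "x \<in> L" unfolding x L(2) by (rule int_spanI)
    ultimately show "x \<in> L \<and> (\<exists>k::int. f x = real_of_int (int m * k))" by blast
  next
    assume "x \<in> L \<and> (\<exists>k::int. f x = real_of_int (int m * k))"
    then obtain c k where x: "x = (\<Sum>i<n. real_of_int (c i) *\<^sub>R b' i)"
      and k: "f x = real_of_int (int m * k)" unfolding L(2) int_span_def by blast
    have ck: "c ?l = int m * k" using fsum[of c] k x by (metis of_int_eq_iff)
    have "x = (\<Sum>i<n. real_of_int ((c(?l := k)) i) *\<^sub>R real (d i) *\<^sub>R b' i)"
      unfolding x by (intro sum.cong) (auto simp: d_def ck simp del: One_nat_def)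
    then show "x \<in> M" unfolding MM by (metis int_spanI)
  qed
  have "M = cong_lattice n b a (int m)"
  proof (rule Set.set_eqI)
    fix x
    have "x \<in> cong_lattice n b a (int m) \<longleftrightarrow> x \<in> L \<and> (\<exists>k::int. f x = real_of_int (int m * k))"
      unfolding cong_lattice_def L(1) int_span_def dvd_def
      using fa by (auto simp: of_int_eq_iff simp del: of_int_sum of_int_mult)
    then show "x \<in> M \<longleftrightarrow> x \<in> cong_lattice n b a (int m)" using Miff by simp
  qed
  moreover have "e dvd 1" if e: "\<forall>i<n. e dvd a i" for e
  proof -
    have "b' ?l \<in> int_span n b" using int_span_base[of ?l n b'] n L by simp
    then obtain c where c: "b' ?l = (\<Sum>i<n. real_of_int (c i) *\<^sub>R b i)" unfolding int_span_def by blast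
    have "real_of_int (\<Sum>i<n. a i * c i) = 1" using fa[of c] c f'[of ?l] n by simp
    then have "(\<Sum>i<n. a i * c i) = 1" by linarith
    moreover have "e dvd (\<Sum>i<n. a i * c i)" using e by (auto intro!: dvd_sum)
    ultimately show ?thesis by simp
  qed
  ultimately show ?thesis by blast
qed

text \<open>Subtracting multiples of \<open>b k\<close> moves all other basis vectors into the kernel of the functional \<open>a\<close>;
  in the resulting basis \<open>a\<close> is just the \<open>k\<close>-th coordinate. The case \<open>m = 1\<close> says that this basis
  generates the whole lattice.\<close>

lemma cong_lattice_pivot:
  assumes k: "k < n" "a k = 1"
  shows "int_span n (\<lambda>j. if j = k then real_of_int m *\<^sub>R b k else b j - real_of_int (a j) *\<^sub>R b k)
    = cong_lattice n b a m"
proof -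
  let ?g = "\<lambda>j. if j = k then real_of_int m *\<^sub>R b k else b j - real_of_int (a j) *\<^sub>R b k"
  let ?R = "{..<n} - {k}"
  have split: "(\<Sum>j<n. h j) = h k + (\<Sum>j\<in>?R. h j)" for h :: "nat \<Rightarrow> 'c::comm_monoid_add"
    using k by (simp add: sum.remove)
  have expand: "(\<Sum>j<n. real_of_int (e j) *\<^sub>R ?g j)
      = (\<Sum>j<n. real_of_int ((e(k := m * e k - (\<Sum>j\<in>?R. a j * e j))) j) *\<^sub>R b j)" for e
  proof -
    have "(\<Sum>j<n. real_of_int (e j) *\<^sub>R ?g j) = real_of_int (m * e k) *\<^sub>R b k
        + (\<Sum>j\<in>?R. real_of_int (e j) *\<^sub>R b j - real_of_int (a j * e j) *\<^sub>R b k)"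
      unfolding split[of "\<lambda>j. real_of_int (e j) *\<^sub>R ?g j"]
      by (intro arg_cong2[of _ _ _ _ "(+)"] sum.cong) (auto simp: algebra_simps)
    also have "\<dots> = real_of_int (m * e k - (\<Sum>j\<in>?R. a j * e j)) *\<^sub>R b k
        + (\<Sum>j\<in>?R. real_of_int (e j) *\<^sub>R b j)"
      by (simp add: sum_subtractf scaleR_sum_left algebra_simps)
    also have "\<dots> = (\<Sum>j<n. real_of_int ((e(k := m * e k - (\<Sum>j\<in>?R. a j * e j))) j) *\<^sub>R b j)"
      unfolding split[of "\<lambda>j. real_of_int ((e(k := m * e k - (\<Sum>j\<in>?R. a j * e j))) j) *\<^sub>R b j"]
      by (intro arg_cong2[of _ _ _ _ "(+)"] sum.cong) auto
    finally show ?thesis .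
  qed
  show ?thesis
  proof
    show "int_span n ?g \<subseteq> cong_lattice n b a m"
    proof
      fix x assume "x \<in> int_span n ?g"
      then obtain e where x: "x = (\<Sum>j<n. real_of_int (e j) *\<^sub>R ?g j)" unfolding int_span_def by blast
      let ?c = "e(k := m * e k - (\<Sum>j\<in>?R. a j * e j))"
      have "(\<Sum>j<n. a j * ?c j) = m * e k" unfolding split[of "\<lambda>j. a j * ?c j"] using k by simp
      then have "m dvd (\<Sum>j<n. a j * ?c j)" by simp
      then show "x \<in> cong_lattice n b a m" unfolding cong_lattice_def x expand by blast
    qed
  next
    show "cong_lattice n b a m \<subseteq> int_span n ?g"
    proof
      fix x assume "x \<in> cong_lattice n b a m"
      then obtain c q where x: "x = (\<Sum>j<n. real_of_int (c j) *\<^sub>R b j)"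
        and q: "(\<Sum>j<n. a j * c j) = m * q" unfolding cong_lattice_def dvd_def by blast
      let ?e = "c(k := q)"
      have "m * q - (\<Sum>j\<in>?R. a j * ?e j) = c k"
        using q k unfolding split[of "\<lambda>j. a j * c j"] by simp
      then have eq: "?e(k := m * ?e k - (\<Sum>j\<in>?R. a j * ?e j)) = c" by simp
      have "x = (\<Sum>j<n. real_of_int (?e j) *\<^sub>R ?g j)" by (simp only: expand x eq)
      then show "x \<in> int_span n ?g" by (metis int_spanI)
    qed
  qed
qed

text \<open>Used for the transposition that moves the pivot to the last place, where the invariant factor
  \<open>m\<close> stands.\<close>

lemma int_span_involution:
  assumes s: "\<And>i. i < n \<Longrightarrow> s i < n \<and> s (s i) = i"
  shows "int_span n (\<lambda>i. b (s i)) = int_span n b"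
proof (intro equalityI int_span_least add_subgroup_int_span)
  show "b (s i) \<in> int_span n b" if "i < n" for i using s[OF that] int_span_base by blast
  show "b i \<in> int_span n (\<lambda>i. b (s i))" if "i < n" for i
    using s[OF that] int_span_base[of "s i" n "\<lambda>i. b (s i)"] by simp
qed

lemma cong_lattice_cyclic:
  fixes b :: "nat \<Rightarrow> 'a::euclidean_space"
  assumes b: "is_lattice_basis n b L" and k: "k < n" "a k = 1" and m: "m > 0"
  shows "has_invariant_factors n (cong_lattice n b a (int m)) L (replicate (n - 1) 1 @ [m])"
proof -
  let ?ds = "replicate (n - 1) 1 @ [m]"
  define s where "s i = (if i = k then n - 1 else if i = n - 1 then k else i)" for i
  have s: "s i < n \<and> s (s i) = i" if "i < n" for i using that k by (auto simp: s_def)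
  have sk: "s i = k \<longleftrightarrow> i = n - 1" if "i < n" for i using that k by (auto simp: s_def)
  define g where "g m j = (if j = k then real_of_int m *\<^sub>R b k else b j - real_of_int (a j) *\<^sub>R b k)"
    for m :: int and j
  have L: "L = int_span n b" using b by (simp add: is_lattice_basis_def)
  have span: "int_span n (\<lambda>i. g m (s i)) = cong_lattice n b a m" for m
  proof -
    have "int_span n (\<lambda>i. g m (s i)) = int_span n (g m)" by (rule int_span_involution[OF s])
    also have "\<dots> = cong_lattice n b a m"
      unfolding g_def by (rule cong_lattice_pivot[of k n a m b, OF k])
    finally show ?thesis .
  qed
  have gL: "int_span n (\<lambda>i. g 1 (s i)) = L" unfolding span cong_lattice_one L ..
  have "b i \<in> span ((\<lambda>i. g 1 (s i)) ` {..<n})" if "i < n" for i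
    using int_span_base[OF that, of b] gL L span_int_span[of n "\<lambda>i. g 1 (s i)"] span_base by metis
  from is_lattice_basis_int_span[OF b this] have b1: "is_lattice_basis n (\<lambda>i. g 1 (s i)) L"
    unfolding gL .
  have ds: "real (?ds ! i) *\<^sub>R g 1 (s i) = g (int m) (s i)" if "i < n" for i
    using that sk[OF that] by (auto simp: g_def nth_append)
  have "g 1 (s i) \<in> span ((\<lambda>i. g (int m) (s i)) ` {..<n})" if i: "i < n" for i
  proof -
    have "?ds ! i \<noteq> 0" using m i by (auto simp: nth_append)
    then have "g 1 (s i) = inverse (real (?ds ! i)) *\<^sub>R g (int m) (s i)" by (simp flip: ds[OF i])
    then show ?thesis using i by (metis (no_types, lifting) span_scale span_base imageI lessThan_iff)
  qed
  from is_lattice_basis_int_span[OF b1 this]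
  have "is_lattice_basis n (\<lambda>i. g (int m) (s i)) (cong_lattice n b a (int m))" unfolding span .
  with is_lattice_basis_cong[of n "\<lambda>i. real (?ds ! i) *\<^sub>R g 1 (s i)", OF ds]
  have "is_lattice_basis n (\<lambda>i. real (?ds ! i) *\<^sub>R g 1 (s i)) (cong_lattice n b a (int m))" by simp
  moreover have "?ds ! i dvd ?ds ! Suc i" if "Suc i < n" for i using that by (auto simp: nth_append)
  ultimately show ?thesis
    unfolding has_invariant_factors_iff using b1 k(1) m by auto
qed

section \<open>Normal forms of primitive functionals modulo a prime power\<close>

text \<open>A functional on \<open>\<int>\<^sup>n\<close> with values in \<open>\<int> / p\<^sup>r\<close> that is onto has a first entry that is a unit. Scaling
  by a unit does not change the kernel, and makes this entry equal to 1. The normal forms are the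
  representatives of the orbits under scaling that this yields: the pivot \<open>k\<close> is the position of the
  first unit.\<close>

definition pivot_choices :: "nat \<Rightarrow> nat \<Rightarrow> nat \<Rightarrow> nat \<Rightarrow> int set" where
  "pivot_choices p r k i =
     (if i < k then {x \<in> {0..<int p ^ r}. int p dvd x} else if i = k then {1} else {0..<int p ^ r})"

definition normal_forms :: "nat \<Rightarrow> nat \<Rightarrow> nat \<Rightarrow> (nat \<Rightarrow> int) set" where
  "normal_forms n p r = (\<Union>k<n. Pi\<^sub>E {..<n} (pivot_choices p r k))"

lemma normal_formsE:
  assumes "a \<in> normal_forms n p r" "prime p" "r > 0"
  obtains k where "k < n" "a k = 1" "\<And>i. i < k \<Longrightarrow> int p dvd a i"
    "\<And>i. i < n \<Longrightarrow> a i \<in> {0..<int p ^ r}" "a \<in> extensional {..<n}"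
proof -
  obtain k where k: "k < n" "a \<in> Pi\<^sub>E {..<n} (pivot_choices p r k)"
    using assms(1) by (auto simp: normal_forms_def)
  have ai: "a i \<in> pivot_choices p r k i" if "i < n" for i using k that by (auto simp: PiE_iff)
  have "1 < int p ^ r" using assms(2,3) prime_gt_1_nat[of p] by (simp add: one_less_power)
  then have "a i \<in> {0..<int p ^ r}" if "i < n" for i
    using ai[OF that] by (auto simp: pivot_choices_def split: if_splits)
  moreover have "int p dvd a i" if "i < k" for i
    using ai[of i] that k(1) by (auto simp: pivot_choices_def)
  moreover have "a k = 1" using ai[OF k(1)] by (simp add: pivot_choices_def)
  ultimately show ?thesis using that[of k] k by (auto simp: PiE_iff)
qed

lemma cong_lattice_normalise:
  assumes p: "prime p" and r: "r > 0" and a: "\<exists>k<n. \<not> int p dvd a k"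
  shows "\<exists>a'\<in>normal_forms n p r. cong_lattice n b a (int p ^ r) = cong_lattice n b a' (int p ^ r)"
proof -
  let ?m = "int p ^ r"
  have m1: "1 < ?m" using p r prime_gt_1_nat[of p] by (simp add: one_less_power)
  then have m0: "0 < ?m" by linarith
  define k where "k = (LEAST k. k < n \<and> \<not> int p dvd a k)"
  have "k < n \<and> \<not> int p dvd a k" unfolding k_def by (rule LeastI_ex) (use a in blast)
  then have k: "k < n" "\<not> int p dvd a k" by auto
  have least: "int p dvd a i" if "i < k" for i
    using not_less_Least[of i "\<lambda>k. k < n \<and> \<not> int p dvd a k"] that k(1) by (auto simp: k_def)
  have pi: "prime (int p)" using p by simp
  have "coprime (a k) ?m"
    using prime_imp_coprime[OF pi k(2)] r by (simp add: coprime_commute)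
  then obtain u where u: "[a k * u = 1] (mod ?m)" using cong_solve_coprime_int by blast
  then have "[u * a k = 1] (mod ?m)" by (simp add: mult.commute)
  then have cop: "coprime u ?m" using coprime_iff_invertible_int by blast
  define a' where "a' = restrict (\<lambda>i. (u * a i) mod ?m) {..<n}"
  have "a' i \<in> pivot_choices p r k i" if i: "i < n" for i
  proof -
    have range: "a' i \<in> {0..<?m}"
      using i pos_mod_bound[OF m0, of "u * a i"] pos_mod_sign[OF m0, of "u * a i"] by (simp add: a'_def)
    consider "i < k" | "i = k" | "k < i" by linarith
    then show ?thesis
    proof cases
      case 1
      have "int p dvd ?m" using r by (simp add: dvd_power)
      then have "int p dvd a' i" using least[OF 1] i by (simp add: a'_def dvd_mod_iff)
      then show ?thesis using 1 range by (simp add: pivot_choices_def)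
    next
      case 2
      have "a' k = 1 mod ?m" using \<open>[u * a k = 1] (mod ?m)\<close> k(1) by (simp add: a'_def cong_def)
      then show ?thesis using 2 m1 by (simp add: pivot_choices_def)
    next
      case 3 then show ?thesis using range by (simp add: pivot_choices_def)
    qed
  qed
  then have "a' \<in> Pi\<^sub>E {..<n} (pivot_choices p r k)" by (auto simp: PiE_iff a'_def)
  then have "a' \<in> normal_forms n p r" using k(1) by (auto simp: normal_forms_def)
  moreover have "?m dvd (\<Sum>i<n. a i * c i) \<longleftrightarrow> ?m dvd (\<Sum>i<n. a' i * c i)" for c
  proof -
    have "[(\<Sum>i<n. a' i * c i) = (\<Sum>i<n. (u * a i) * c i)] (mod ?m)"
      by (intro cong_sum cong_mult cong_refl) (auto simp: a'_def cong_def)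
    then have "?m dvd (\<Sum>i<n. a' i * c i) \<longleftrightarrow> ?m dvd (\<Sum>i<n. (u * a i) * c i)"
      by (simp add: cong_def dvd_eq_mod_eq_0)
    also have "(\<Sum>i<n. (u * a i) * c i) = u * (\<Sum>i<n. a i * c i)"
      by (simp add: sum_distrib_left mult.assoc)
    also have "?m dvd u * (\<Sum>i<n. a i * c i) \<longleftrightarrow> ?m dvd (\<Sum>i<n. a i * c i)"
      by (rule coprime_dvd_mult_right_iff) (use cop in \<open>simp add: coprime_commute\<close>)
    finally show ?thesis by simp
  qed
  ultimately show ?thesis unfolding cong_lattice_def by blast
qed

text \<open>The vectors \<open>b j - a j b k\<close> lie in the first lattice, hence in the second, so \<open>a' j\<close> is congruent to
  \<open>a' k * a j\<close>. If the pivot \<open>k\<close> of \<open>a\<close> came before that of \<open>a'\<close>, then \<open>p\<close> would divide \<open>a' k\<close> and so all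
  entries of \<open>a'\<close>, including its pivot entry 1. So the pivots agree, and the congruence makes the
  entries equal.\<close>

lemma cong_lattice_inj:
  fixes b :: "nat \<Rightarrow> 'a::euclidean_space"
  assumes b: "is_lattice_basis n b L" and p: "prime p" and r: "r > 0"
  shows "inj_on (\<lambda>a. cong_lattice n b a (int p ^ r)) (normal_forms n p r)"
proof (rule inj_onI)
  let ?m = "int p ^ r"
  fix a a' assume a: "a \<in> normal_forms n p r" and a': "a' \<in> normal_forms n p r"
    and eq: "cong_lattice n b a ?m = cong_lattice n b a' ?m"
  obtain k where k: "k < n" "a k = 1" "\<And>i. i < k \<Longrightarrow> int p dvd a i"
    "\<And>i. i < n \<Longrightarrow> a i \<in> {0..<?m}" "a \<in> extensional {..<n}" using normal_formsE[OF a p r] by metis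
  obtain k' where k': "k' < n" "a' k' = 1" "\<And>i. i < k' \<Longrightarrow> int p dvd a' i"
    "\<And>i. i < n \<Longrightarrow> a' i \<in> {0..<?m}" "a' \<in> extensional {..<n}" using normal_formsE[OF a' p r] by metis
  have same: "?m dvd (\<Sum>i<n. a i * c i) \<longleftrightarrow> ?m dvd (\<Sum>i<n. a' i * c i)" for c
    using in_cong_lattice_iff[OF b] eq by metis
  \<comment> \<open>The functional \<open>h\<close> evaluated at \<open>b j - z b k\<close>.\<close>
  have test: "(\<Sum>i<n. h i * ((if i = j then 1 else 0) - (if i = k then z else 0))) = h j - h k * z"
    if "j < n" "k < n" for h :: "nat \<Rightarrow> int" and j k z
    using that by (simp add: right_diff_distrib sum_subtractf if_distrib[of "\<lambda>t. _ * t"] cong: if_cong)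
  have 1: "?m dvd a' j - a' k * a j" if "j < n" for j
    using same[of "\<lambda>i. (if i = j then 1 else 0) - (if i = k then a j else 0)"] k that
    by (simp add: test)
  have 2: "?m dvd a j - a k' * a' j" if "j < n" for j
    using same[of "\<lambda>i. (if i = j then 1 else 0) - (if i = k' then a' j else 0)"] k' that
    by (simp add: test)
  have pm: "int p dvd ?m" using r by (simp add: dvd_power)
  have p1: "\<not> int p dvd 1" using prime_gt_1_nat[OF p] by simp
  have "\<not> k < k'"
  proof
    assume "k < k'"
    then have "int p dvd a' k' - a' k * a k'" "int p dvd a' k" using 1[OF k'(1)] pm k'(3) by (auto intro: dvd_trans)
    then have "int p dvd (a' k' - a' k * a k') + a' k * a k'" by (intro dvd_add dvd_mult2)
    then show False using p1 k' by simp
  qed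
  moreover have "\<not> k' < k"
  proof
    assume "k' < k"
    then have "int p dvd a k - a k' * a' k" "int p dvd a k'" using 2[OF k(1)] pm k(3) by (auto intro: dvd_trans)
    then have "int p dvd (a k - a k' * a' k) + a k' * a' k" by (intro dvd_add dvd_mult2)
    then show False using p1 k by simp
  qed
  ultimately have kk: "k' = k" by simp
  have "a j = a' j" if j: "j < n" for j
  proof -
    have "?m dvd a' j - a j" using 1[OF j] k'(2) kk by simp
    moreover have "\<bar>a' j - a j\<bar> < ?m" using k(4)[OF j] k'(4)[OF j] by auto
    ultimately show ?thesis using zdvd_not_zless[of "\<bar>a' j - a j\<bar>" ?m] by force
  qed
  then show "a = a'" using k(5) k'(5) by (intro extensionalityI) auto
qed

lemma prod_pivot:
  fixes x y :: nat
  assumes "k < n"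
  shows "(\<Prod>i<n. if i < k then x else if i = k then 1 else y) = x ^ k * y ^ (n - 1 - k)"
proof -
  obtain d where n: "n = Suc k + d" using assms less_imp_Suc_add[of k n] by auto
  show ?thesis unfolding n by (induction d) (auto simp: algebra_simps)
qed

text \<open>For the pivot \<open>k\<close> there are \<open>p ^ (r - 1)\<close> choices at each of the \<open>k\<close> earlier positions and \<open>p ^ r\<close> at
  each of the \<open>n - 1 - k\<close> later ones; the exponents add up to \<open>(n - 1) * r - k\<close>.\<close>

lemma card_normal_forms:
  assumes p: "prime p" and r: "r > 0"
  shows "card (normal_forms n p r) = (\<Sum>k<n. p ^ ((n - 1) * r - k))"
proof -
  have p0: "p > 0" using p by (rule prime_gt_0_nat)
  have mult: "card {x \<in> {0..<int p ^ r}. int p dvd x} = p ^ (r - 1)"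
  proof -
    have pr: "int p ^ r = int p * int p ^ (r - 1)" using r by (simp flip: power_Suc)
    have "{x \<in> {0..<int p ^ r}. int p dvd x} = (\<lambda>y. int p * y) ` {0..<int p ^ (r - 1)}"
      using p0 by (auto simp: pr elim!: dvdE simp: zero_le_mult_iff)
    moreover have "inj (\<lambda>y. int p * y)" using p0 by (simp add: inj_on_def)
    ultimately show ?thesis
      by (simp add: card_image[OF inj_on_subset[of _ UNIV]] flip: of_nat_power)
  qed
  have card_choices: "card (pivot_choices p r k i) = (if i < k then p ^ (r - 1) else if i = k then 1 else p ^ r)" for k i
  proof -
    have all: "card {0..<int p ^ r} = p ^ r" by (simp flip: of_nat_power)
    consider "i < k" | "i = k" | "\<not> i < k" "i \<noteq> k" by blast
    then show ?thesis
      by cases (simp_all only: pivot_choices_def mult all if_True if_False less_irrefl refl card_1_singleton_iff, auto)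
  qed
  have cardk: "card (Pi\<^sub>E {..<n} (pivot_choices p r k)) = p ^ ((n - 1) * r - k)" if k: "k < n" for k
  proof -
    have "card (Pi\<^sub>E {..<n} (pivot_choices p r k)) = (p ^ (r - 1)) ^ k * (p ^ r) ^ (n - 1 - k)"
      using prod_pivot[OF k] by (simp add: card_PiE card_choices)
    also have "\<dots> = p ^ ((r - 1) * k + r * (n - 1 - k))" by (simp add: power_add power_mult)
    also have "(r - 1) * k + r * (n - 1 - k) = (n - 1) * r - k"
    proof -
      obtain r' d where "r = Suc r'" "n = Suc k + d" using r k less_imp_Suc_add[of k n] by (cases r) auto
      then show ?thesis by (simp add: algebra_simps)
    qed
    finally show ?thesis .
  qed
  have disj: "Pi\<^sub>E {..<n} (pivot_choices p r k) \<inter> Pi\<^sub>E {..<n} (pivot_choices p r k') = {}"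
    if "k < k'" "k' < n" for k k'
  proof -
    have "False" if "a \<in> Pi\<^sub>E {..<n} (pivot_choices p r k)" "a \<in> Pi\<^sub>E {..<n} (pivot_choices p r k')" for a
    proof -
      have "a k \<in> pivot_choices p r k k" "a k \<in> pivot_choices p r k' k"
        using that \<open>k < k'\<close> \<open>k' < n\<close> by (auto simp: PiE_iff)
      then have "int p dvd 1" using \<open>k < k'\<close> by (simp add: pivot_choices_def)
      then show False using prime_gt_1_nat[OF p] by simp
    qed
    then show ?thesis by blast
  qed
  have "finite (pivot_choices p r k i)" for k i
    by (rule finite_subset[of _ "{0..<int p ^ r} \<union> {1}"]) (auto simp: pivot_choices_def)
  then have "card (normal_forms n p r) = (\<Sum>k<n. card (Pi\<^sub>E {..<n} (pivot_choices p r k)))"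
    unfolding normal_forms_def
    by (intro card_UN_disjoint) (auto intro!: finite_PiE, metis disj disjoint_iff nat_neq_iff)
  then show ?thesis using cardk by simp
qed

lemma num_cyclic_sublattices:
  fixes L :: "'a::euclidean_space set"
  assumes n: "n > 0" and L: "is_lattice n L" and p: "prime p" and r: "r > 0"
  shows "num_sublattices_invariant_factors n L (replicate (n - 1) 1 @ [p ^ r])
    = (\<Sum>k<n. p ^ ((n - 1) * r - k))"
proof -
  obtain b where b: "is_lattice_basis n b L" using L by (auto simp: is_lattice_def)
  let ?ds = "replicate (n - 1) 1 @ [p ^ r]"
  have p1: "\<not> int p dvd 1" using prime_gt_1_nat[OF p] by simp
  have "{M. is_sublattice n M L \<and> has_invariant_factors n M L ?ds}
      = (\<lambda>a. cong_lattice n b a (int p ^ r)) ` normal_forms n p r"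
  proof (intro equalityI subsetI)
    fix M assume "M \<in> {M. is_sublattice n M L \<and> has_invariant_factors n M L ?ds}"
    then obtain a where a: "M = cong_lattice n b a (int p ^ r)" "\<forall>d. (\<forall>i<n. d dvd a i) \<longrightarrow> d dvd 1"
      using cyclic_imp_cong_lattice[OF n b, of M "p ^ r"] by auto
    then have "\<exists>k<n. \<not> int p dvd a k" using p1 by blast
    from cong_lattice_normalise[where a = a and b = b, OF p r this] a(1)
    show "M \<in> (\<lambda>a. cong_lattice n b a (int p ^ r)) ` normal_forms n p r" by auto
  next
    fix M assume "M \<in> (\<lambda>a. cong_lattice n b a (int p ^ r)) ` normal_forms n p r"
    then obtain a where a: "a \<in> normal_forms n p r" "M = cong_lattice n b a (int p ^ r)" by blast
    obtain k where "k < n" "a k = 1" using normal_formsE[OF a(1) p r] by metis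
    then have h: "has_invariant_factors n M L ?ds"
      using cong_lattice_cyclic[OF b, of k a "p ^ r"] p a(2) by (simp add: prime_gt_0_nat)
    then have "is_lattice n M" unfolding has_invariant_factors_iff is_lattice_def by blast
    moreover have "M \<subseteq> L" using a(2) b
      by (auto simp: cong_lattice_def is_lattice_basis_def int_span_def)
    ultimately show "M \<in> {M. is_sublattice n M L \<and> has_invariant_factors n M L ?ds}"
      using h by (simp add: is_sublattice_def)
  qed
  then show ?thesis
    unfolding num_sublattices_invariant_factors_def
    by (simp add: card_image[OF cong_lattice_inj[OF b p r]] card_normal_forms[OF p r])
qed

section \<open>The two leading coefficients\<close>

definition cyclic_poly :: "nat \<Rightarrow> nat \<Rightarrow> int poly" where
  "cyclic_poly n r = (\<Sum>k<n. monom 1 ((n - 1) * r - k))"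

definition leading_two_ones :: "nat \<Rightarrow> 'a::comm_semiring_1 poly \<Rightarrow> bool" where
  "leading_two_ones d f \<longleftrightarrow> degree f = d \<and> coeff f d = 1 \<and> coeff f (d - 1) = 1"

lemma coeff_cyclic_poly:
  assumes n: "n > 0" and r: "r > 0"
  shows "coeff (cyclic_poly n r) i = (if (n - 1) * r < i + n \<and> i \<le> (n - 1) * r then 1 else 0)"
proof -
  define D where "D = (n - 1) * r"
  have D: "n - 1 \<le> D" using r by (simp add: D_def)
  have "coeff (cyclic_poly n r) i = (\<Sum>k<n. if k = D - i \<and> i \<le> D then 1 else 0)"
    unfolding cyclic_poly_def coeff_sum D_def[symmetric] using D by (intro sum.cong) auto
  also have "\<dots> = (if D < i + n \<and> i \<le> D then 1 else 0)"
    using n by (cases "i \<le> D") auto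
  finally show ?thesis by (simp add: D_def)
qed

lemma cyclic_poly_leading:
  assumes n: "n \<ge> 2" and r: "r > 0"
  shows "leading_two_ones ((n - 1) * r) (cyclic_poly n r)"
proof -
  let ?D = "(n - 1) * r"
  have c: "coeff (cyclic_poly n r) i = (if ?D < i + n \<and> i \<le> ?D then 1 else 0)" for i
    using coeff_cyclic_poly n r by simp
  have "?D > 0" using n r by simp
  then show ?thesis unfolding leading_two_ones_def using n
    by (auto simp: c intro!: antisym degree_le le_degree)
qed

lemma coeff_index_poly_Suc:
  "coeff (index_poly (Suc n) r) i = (\<Sum>j\<le>r. if j \<le> i then coeff (index_poly n j) (i - j) else 0)"
  unfolding index_poly.simps coeff_sum by (intro sum.cong) (auto simp: coeff_monom_mult)

lemma coeff_index_poly_eq_0: "i > n * r \<Longrightarrow> coeff (index_poly (Suc n) r) i = 0"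
proof (induction n arbitrary: r i)
  case 0
  then show ?case unfolding coeff_index_poly_Suc by (auto intro!: sum.neutral)
next
  case (Suc n)
  have "coeff (index_poly (Suc n) j) (i - j) = 0" if "j \<le> r" for j
  proof (rule Suc.IH)
    have "Suc n * j \<le> Suc n * r" using that by (intro mult_le_mono2)
    then show "n * j < i - j" using Suc.prems by simp
  qed
  then show ?case unfolding coeff_index_poly_Suc[of "Suc n"] by (intro sum.neutral) auto
qed

text \<open>In the recursion the summand for \<open>j < r\<close> has degree at most \<open>(n + 1) * j\<close>, which is at least \<open>n + 1\<close>
  below \<open>(n + 1) * r\<close>. So the top \<open>n + 1\<close> coefficients come from the summand for \<open>j = r\<close> alone.\<close>

lemma coeff_index_poly_top:
  assumes e: "e \<le> n" "e \<le> n * r"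
  shows "coeff (index_poly (Suc (Suc n)) r) (Suc n * r - e) = coeff (index_poly (Suc n) r) (n * r - e)"
proof -
  define i where "i = Suc n * r - e"
  have "coeff (index_poly (Suc (Suc n)) r) i
      = (\<Sum>j\<le>r. if j = r then coeff (index_poly (Suc n) r) (i - r) else 0)"
    unfolding coeff_index_poly_Suc[of "Suc n"]
  proof (intro sum.cong refl)
    fix j assume "j \<in> {..r}"
    then consider "j = r" | "j < r" by fastforce
    then show "(if j \<le> i then coeff (index_poly (Suc n) j) (i - j) else 0)
        = (if j = r then coeff (index_poly (Suc n) r) (i - r) else 0)"
    proof cases
      case 1
      then show ?thesis using e(2) by (simp add: i_def)
    next
      case 2
      then have "Suc n * Suc j \<le> Suc n * r" by (intro mult_le_mono2) simp
      then have "n * j < i - j" using e(1) by (simp add: i_def)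
      then show ?thesis using 2 by (simp add: coeff_index_poly_eq_0 del: index_poly.simps)
    qed
  qed
  also have "\<dots> = coeff (index_poly (Suc n) r) (i - r)" by simp
  also have "i - r = n * r - e" by (simp add: i_def)
  finally show ?thesis by (simp only: i_def)
qed

lemma index_poly_1: "index_poly (Suc 0) r = 1"
proof -
  have "index_poly (Suc 0) r = (\<Sum>j\<le>r. if j = 0 then 1 else 0)"
    unfolding index_poly.simps by (intro sum.cong) auto
  then show ?thesis by simp
qed

text \<open>The induction starts at rank 2, where the polynomial is \<open>1 + x + \<dots> + x ^ r\<close>. In rank 1 it is constant,
  and only one leading coefficient exists.\<close>

lemma index_poly_leading:
  assumes n: "n \<ge> 2" and r: "r > 0"
  shows "leading_two_ones ((n - 1) * r) (index_poly n r)"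
proof -
  have top: "coeff (index_poly (Suc (Suc k)) r) (Suc k * r - e) = 1" if e: "e \<le> 1" for e k
  proof (induction k)
    case 0
    have "coeff (index_poly (Suc (Suc 0)) r) (r - e) = (\<Sum>j\<le>r. if j = r - e then 1 else 0)"
      unfolding coeff_index_poly_Suc[of "Suc 0"] index_poly_1 by (intro sum.cong) auto
    then show ?case by simp
  next
    case (Suc k)
    have "1 \<le> Suc k * r" using r by simp
    then have "e \<le> Suc k * r" using e by linarith
    moreover have "e \<le> Suc k" using e by simp
    ultimately show ?case using coeff_index_poly_top[of e "Suc k" r] Suc.IH by (simp only:)
  qed
  obtain k where k: "n = Suc (Suc k)" using n by (metis add_2_eq_Suc le_Suc_ex)
  have "degree (index_poly n r) \<le> Suc k * r"
    unfolding k by (rule degree_le) (blast intro: coeff_index_poly_eq_0)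
  moreover have "coeff (index_poly n r) (Suc k * r) = 1" using top[of 0 k] by (simp add: k del: index_poly.simps)
  moreover have "coeff (index_poly n r) (Suc k * r - 1) = 1" using top[of 1 k] by (simp only: k)
  ultimately show ?thesis
    by (simp only: leading_two_ones_def k diff_Suc_1) (metis le_antisym le_degree zero_neq_one)
qed

lemma leading_two_ones_tendsto:
  fixes f :: "int poly"
  assumes "leading_two_ones d f"
  shows "(\<lambda>p::nat. real_of_int (poly f (int p)) / real p ^ d) \<longlonglongrightarrow> 1"
proof -
  define g where "g = map_poly real_of_int f"
  have dg: "degree g = degree f" unfolding g_def by (rule degree_map_poly) simp
  have cg: "coeff g i = real_of_int (coeff f i)" for i unfolding g_def by (simp add: coeff_map_poly)
  have "((\<lambda>x. poly g x / x ^ degree g) \<longlongrightarrow> lead_coeff g) at_infinity"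
    by (rule poly_divide_tendsto_aux)
  moreover have "filterlim real at_infinity sequentially" by (rule tendsto_of_nat)
  ultimately have "(\<lambda>p. poly g (real p) / real p ^ degree g) \<longlonglongrightarrow> lead_coeff g"
    by (rule filterlim_compose)
  moreover have "poly g (real p) = real_of_int (poly f (int p))" for p
    by (simp add: poly_altdef dg cg)
  moreover have "degree g = d" "lead_coeff g = 1" using assms by (auto simp: leading_two_ones_def dg cg)
  ultimately show ?thesis by simp
qed

theorem mainTheorem14:
  fixes n r :: nat
  assumes "n > 2" and "r > 0"
  shows
    "(\<exists>F G :: int poly.
        degree F = (n - 1) * r \<and> coeff F ((n - 1) * r) = 1 \<and> coeff F ((n - 1) * r - 1) = 1 \<and>
        degree G = (n - 1) * r \<and> coeff G ((n - 1) * r) = 1 \<and> coeff G ((n - 1) * r - 1) = 1 \<and>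
        (\<forall>\<Lambda> :: 'a::euclidean_space set. is_lattice n \<Lambda> \<longrightarrow>
           (\<forall>p::nat. prime p \<longrightarrow>
              int (num_sublattices_index n \<Lambda> (p ^ r)) = poly F (int p) \<and>
              int (num_sublattices_invariant_factors n \<Lambda> (replicate (n - 1) 1 @ [p ^ r]))
                = poly G (int p))))
     \<and> (\<forall>\<Lambda> :: 'a set. is_lattice n \<Lambda> \<longrightarrow>
          ((\<lambda>p::nat.
              real (num_sublattices_invariant_factors n \<Lambda> (replicate (n - 1) 1 @ [p ^ r]))
              / real (num_sublattices_index n \<Lambda> (p ^ r)))
            \<longlongrightarrow> 1) (inf at_top (principal {p. prime p})))"
proof -
  let ?F = "index_poly n r" and ?G = "cyclic_poly n r" and ?D = "(n - 1) * r"
  have F: "leading_two_ones ?D ?F" by (rule index_poly_leading) (use assms in auto)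
  have G: "leading_two_ones ?D ?G" by (rule cyclic_poly_leading) (use assms in auto)
  have F_count: "int (num_sublattices_index n L (p ^ r)) = poly ?F (int p)"
    if L: "is_lattice n L" and p: "prime p" for L :: "'a set" and p
  proof -
    obtain b where b: "is_lattice_basis n b L" using L by (auto simp: is_lattice_def)
    then have "L = int_span n b" by (simp add: is_lattice_basis_def)
    then show ?thesis
      using card_sublattices_prime_power[OF _ p, of n b r] b
      by (simp add: num_sublattices_index_def sublattices_of_index_def)
  qed
  have G_count: "int (num_sublattices_invariant_factors n L (replicate (n - 1) 1 @ [p ^ r]))
      = poly ?G (int p)"
    if "is_lattice n L" "prime p" for L :: "'a set" and p
    using num_cyclic_sublattices[OF _ that assms(2)] assms(1)
    by (simp add: cyclic_poly_def poly_sum poly_monom)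
  have limit: "((\<lambda>p::nat.
        real (num_sublattices_invariant_factors n L (replicate (n - 1) 1 @ [p ^ r]))
        / real (num_sublattices_index n L (p ^ r))) \<longlongrightarrow> 1) (inf at_top (principal {p. prime p}))"
    if L: "is_lattice n L" for L :: "'a set"
  proof -
    let ?q = "\<lambda>f p. real_of_int (poly f (int p)) / real p ^ ?D"
    have "(\<lambda>p. ?q ?G p / ?q ?F p) \<longlonglongrightarrow> 1 / 1"
      by (intro tendsto_divide leading_two_ones_tendsto F G) simp
    then have "((\<lambda>p. ?q ?G p / ?q ?F p) \<longlongrightarrow> 1) (inf at_top (principal {p. prime p}))"
      by (intro tendsto_mono[OF inf_le1]) simp
    moreover have "\<forall>\<^sub>F p in inf at_top (principal {p. prime p}). ?q ?G p / ?q ?F p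
        = real (num_sublattices_invariant_factors n L (replicate (n - 1) 1 @ [p ^ r]))
        / real (num_sublattices_index n L (p ^ r))"
      unfolding eventually_inf_principal
    proof (intro always_eventually allI impI)
      fix p :: nat assume "p \<in> {p. prime p}"
      then have p: "prime p" by simp
      have "real p ^ ?D \<noteq> 0" using prime_gt_0_nat[OF p] by simp
      then have "?q ?G p / ?q ?F p = real_of_int (poly ?G (int p)) / real_of_int (poly ?F (int p))"
        by simp
      then show "?q ?G p / ?q ?F p
        = real (num_sublattices_invariant_factors n L (replicate (n - 1) 1 @ [p ^ r]))
        / real (num_sublattices_index n L (p ^ r))"
        by (simp only: F_count[OF L p, symmetric] G_count[OF L p, symmetric] of_int_of_nat_eq)
    qed
    ultimately show ?thesis by (rule Lim_transform_eventually)
  qed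
  show ?thesis
    using F G F_count G_count limit unfolding leading_two_ones_def
    by (intro conjI exI[of _ ?F] exI[of _ ?G] allI impI) auto
qed

end
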